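(* Let $k\ge1$ and $n>k$ be integers. Then $$\inf_{\mathbf G}\ \mathrm{innerLP}^{\mathsf{ST}/\mathsf{Proph}}_{k,n}(\mathbf G)=\inf_{\mathbf G}\ \mathrm{innerLP}^{\mathsf{ST}/\mathsf{ExAnte}}_{k,n}(\mathbf G)=\inf_{\mathbf G}\sup_{J,\rho}\ \mathrm{innerLP}^{\mathsf{OST}(J,\rho)/\mathsf{Proph}}_{k,n}(\mathbf G)=\inf_{\mathbf G}\sup_{J,\rho}\ \mathrm{innerLP}^{\mathsf{OST}(J,\rho)/\mathsf{ExAnte}}_{k,n}(\mathbf G),$$ where the infima are over all type distributions $\mathbf G$ for $n$ agents (with any finite number $m$ of types), and the suprema are over $J\in[m]$, $\rho\in(0,1]$.
   Context: $[n]=\{1,\dots,n\}$. $\mathrm{Ber}(p)$ denotes a Bernoulli random variable with mean $p$; all Bernoulli variables in a sum are independent. Type distributions $\mathbf G$ (for $n$ agents): a positive integer $m$ and numbers $G_{ij}$, $i\in[n]$, $j\in\{0,1,\dots,m\}$, with $0=G_{i0}\le G_{i1}\le\cdots\le G_{im}=1$ for every $i$. $\mathcal P^k_n$ is the set of pairs $(\mathbf x,\mathbf y)$ of real arrays $\mathbf x=(x^l_i)_{i\in[n],l\in[k]}$, $\mathbf y=(y^l_i)_{i\in[n],l\in[k]}$ such that $0\le y^l_i\le x^l_i$ for all $i,l$; $x^k_1=1$; $x^l_1=0$ for $l<k$; and $x^l_i=x^l_{i-1}-y^l_{i-1}+y^{l+1}_{i-1}$ for all $i>1$, $l\in[k]$,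 with the convention $y^{k+1}_{i}=0$. Put $Q_j=\mathbb E[\min\{\sum_{i=1}^n\mathrm{Ber}(G_{ij}),k\}]$ in the problems with superscript "$/\mathsf{Proph}$" and $Q_j=\min\{\sum_{i=1}^nG_{ij},k\}$ in those with superscript "$/\mathsf{ExAnte}$". For $J\in[m]$, $\rho\in(0,1]$, $\mathrm{innerLP}^{\mathsf{OST}(J,\rho)/\cdot}_{k,n}(\mathbf G)$ is the optimal value of: maximize $\theta$ over real $\theta$ and $(\mathbf x,\mathbf y)\in\mathcal P^k_n$ subject to $$\theta\cdot Q_j\le\sum_{i=1}^n\sum_{l=1}^k\min\{y^l_i,G_{ij}x^l_i\}\quad\forall j\in[m],\qquad y^l_i=((1-\rho)G_{i,J-1}+\rho G_{iJ})x^l_i\quad\forall i\in[n],l\in[k].$$ For each $(J,\rho)$ let $(\mathbf x(J,\rho),\mathbf y(J,\rho))$ be the unique element of $\mathcal P^k_n$ with $y^l_i(J,\rho)=((1-\rho)G_{i,J-1}+\rho G_{iJ})x^l_i(J,\rho)$ for all $i,l$. Then $\mathrm{innerLP}^{\mathsf{ST}/\cdot}_{k,n}(\mathbf G)$ is the optimal value (supremum) of $\theta$ over real $\theta$ and probability measures $\mu$ on $[m]\times(0,1]$ subject to $$\theta\cdot Q_j\le\int\Big(\sum_{i=1}^n\sum_{l=1}^k\min\{y^l_i(J,\rho),G_{ij}x^l_i(J,\rho)\}\Big)\,d\mu(J,\rho)\quad\forall j\in[m].$$ *)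

theory Defs
  imports "HOL-Probability.Probability"
begin

text \<open>
  Agents are \<open>i \<in> {1..n}\<close>, units are \<open>l \<in> {1..k}\<close> and types are \<open>j \<in> {1..m}\<close>;
  \<open>G i j\<close>, \<open>x i l\<close>, \<open>y i l\<close> stand for \<open>G\<^sub>i\<^sub>j\<close>, \<open>x\<^sub>i\<^sup>l\<close>, \<open>y\<^sub>i\<^sup>l\<close>.
  A type distribution is the pair \<open>(m, G)\<close>. Values of \<open>G\<close> outside \<open>{1..n} \<times> {0..m}\<close>
  are unconstrained and are never used below.
\<close>

definition type_distributions :: "nat \<Rightarrow> (nat \<times> (nat \<Rightarrow> nat \<Rightarrow> real)) set" where
  "type_distributions n = {(m, G). m \<ge> 1 \<and>
     (\<forall>i\<in>{1..n}. G i 0 = 0 \<and> (\<forall>j<m. G i j \<le> G i (Suc j)) \<and> G i m = 1)}"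

text \<open>
  The arrays are extensional functions, so that an element of the set below is determined
  by its entries with \<open>i \<in> {1..n}\<close>, \<open>l \<in> {1..k}\<close>. The conditional encodes the convention
  \<open>y\<^sub>i\<^sup>k\<^sup>+\<^sup>1 = 0\<close>.
\<close>

definition policies :: "nat \<Rightarrow> nat \<Rightarrow> ((nat \<Rightarrow> nat \<Rightarrow> real) \<times> (nat \<Rightarrow> nat \<Rightarrow> real)) set" where
  "policies k n = {(x, y).
     x \<in> {1..n} \<rightarrow>\<^sub>E ({1..k} \<rightarrow>\<^sub>E UNIV) \<and>
     y \<in> {1..n} \<rightarrow>\<^sub>E ({1..k} \<rightarrow>\<^sub>E UNIV) \<and>
     (\<forall>i\<in>{1..n}. \<forall>l\<in>{1..k}. 0 \<le> y i l \<and> y i l \<le> x i l) \<and>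
     x 1 k = 1 \<and>
     (\<forall>l\<in>{1..<k}. x 1 l = 0) \<and>
     (\<forall>i\<in>{2..n}. \<forall>l\<in>{1..k}.
        x i l = x (i - 1) l - y (i - 1) l + (if l < k then y (i - 1) (l + 1) else 0))}"

datatype benchmark = Proph | ExAnte

fun Q :: "benchmark \<Rightarrow> nat \<Rightarrow> nat \<Rightarrow> (nat \<Rightarrow> nat \<Rightarrow> real) \<Rightarrow> nat \<Rightarrow> real" where
  "Q Proph k n G j =
     measure_pmf.expectation (Pi_pmf {1..n} False (\<lambda>i. bernoulli_pmf (G i j)))
       (\<lambda>b. min (\<Sum>i=1..n. of_bool (b i)) (real k))"
| "Q ExAnte k n G j = min (\<Sum>i=1..n. G i j) (real k)"

definition accepted :: "nat \<Rightarrow> nat \<Rightarrow> (nat \<Rightarrow> nat \<Rightarrow> real) \<Rightarrow> nat \<Rightarrow>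
    (nat \<Rightarrow> nat \<Rightarrow> real) \<times> (nat \<Rightarrow> nat \<Rightarrow> real) \<Rightarrow> real" where
  "accepted k n G j = (\<lambda>(x, y). \<Sum>i=1..n. \<Sum>l=1..k. min (y i l) (G i j * x i l))"

definition threshold_policies :: "nat \<Rightarrow> nat \<Rightarrow> (nat \<Rightarrow> nat \<Rightarrow> real) \<Rightarrow> nat \<Rightarrow> real \<Rightarrow>
    ((nat \<Rightarrow> nat \<Rightarrow> real) \<times> (nat \<Rightarrow> nat \<Rightarrow> real)) set" where
  "threshold_policies k n G J \<rho> = {(x, y) \<in> policies k n.
     \<forall>i\<in>{1..n}. \<forall>l\<in>{1..k}. y i l = ((1 - \<rho>) * G i (J - 1) + \<rho> * G i J) * x i l}"

text \<open>Optimal values are suprema in \<^typ>\<open>ereal\<close>, so no boundedness side condition arises.\<close>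

definition innerLP_OST ::
    "benchmark \<Rightarrow> nat \<Rightarrow> nat \<Rightarrow> nat \<Rightarrow> (nat \<Rightarrow> nat \<Rightarrow> real) \<Rightarrow> nat \<Rightarrow> real \<Rightarrow> ereal" where
  "innerLP_OST b k n m G J \<rho> = Sup {ereal \<theta> | \<theta>.
     \<exists>p \<in> threshold_policies k n G J \<rho>. \<forall>j\<in>{1..m}. \<theta> * Q b k n G j \<le> accepted k n G j p}"

definition threshold_policy :: "nat \<Rightarrow> nat \<Rightarrow> (nat \<Rightarrow> nat \<Rightarrow> real) \<Rightarrow> nat \<Rightarrow> real \<Rightarrow>
    (nat \<Rightarrow> nat \<Rightarrow> real) \<times> (nat \<Rightarrow> nat \<Rightarrow> real)" where
  "threshold_policy k n G J \<rho> = (THE p. p \<in> threshold_policies k n G J \<rho>)"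

definition threshold_distributions :: "nat \<Rightarrow> (nat \<times> real) measure set" where
  "threshold_distributions m = {\<mu>. prob_space \<mu> \<and>
     sets \<mu> = sets (count_space {1..m} \<Otimes>\<^sub>M restrict_space borel {0<..1})}"

text \<open>
  For a type distribution \<open>(m, G)\<close> the integrand below is bounded and, in \<open>\<rho>\<close>, continuous,
  so the Bochner integral is the expectation.
\<close>

definition innerLP_ST :: "benchmark \<Rightarrow> nat \<Rightarrow> nat \<Rightarrow> nat \<Rightarrow> (nat \<Rightarrow> nat \<Rightarrow> real) \<Rightarrow> ereal" where
  "innerLP_ST b k n m G = Sup {ereal \<theta> | \<theta>.
     \<exists>\<mu> \<in> threshold_distributions m. \<forall>j\<in>{1..m}.
       \<theta> * Q b k n G j \<le> (LINT (J, \<rho>)|\<mu>. accepted k n G j (threshold_policy k n G J \<rho>))}"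

end

theory Submission imports Defs begin

text \<open>
  Of the four values, \<open>ST/Proph\<close> is the largest and \<open>OST/ExAnte\<close> the smallest for every \<open>G\<close>, so it
  suffices to find \<open>v\<close> above the infimum of the former and below the infimum of the latter.
  Let \<open>N = n - 1\<close> and let \<open>B\<close> be binomial with \<open>N\<close> trials and the success probability for which
  \<open>P(B < k) = E[min B k] / k\<close>; then \<open>v\<close> is this common value.

  Lower bound: with acceptance probabilities \<open>p\<close>, the number \<open>S\<^sub>i\<close> of accepting agents among the
  first \<open>i\<close> is Poisson binomial. By continuity some threshold satisfies
  \<open>E[min S\<^sub>n k] = k P(S\<^sub>N < k)\<close>, and this common ratio is feasible for \<open>OST/ExAnte\<close>: types above the
  threshold use the second expression and types below it the first one. It is at least \<open>v\<close>, because
  by Newton's inequalities the binomial distribution minimises \<open>E[min S\<^sub>N k]\<close> for given \<open>P(S\<^sub>N < k)\<close>.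

  Upper bound: let the last agent have the top type with small probability and nothing else until the
  end, and the other agents be identical. A static policy then produces, up to a small error, a mixture
  of points \<open>(P(B' < k), E[min B' k] / k)\<close> with \<open>B'\<close> binomial. These points form a concave curve, whose
  tangent at the balanced point shows that mixing does not help.
\<close>

subsection \<open>The Poisson binomial distribution\<close>

text \<open>
  \<open>pbin p N j\<close>, \<open>less_prob p N k\<close> and \<open>capped_mean p N k\<close> are the probabilities of \<open>S = j\<close> and
  \<open>S < k\<close> and the mean of \<open>min S k\<close>, where \<open>S\<close> is a sum of independent \<open>Ber(p 1), \<dots>, Ber(p N)\<close>.
\<close>

primrec pbin :: "(nat \<Rightarrow> real) \<Rightarrow> nat \<Rightarrow> nat \<Rightarrow> real" where
  "pbin p 0 j = of_bool (j = 0)"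
| "pbin p (Suc N) j =
     (1 - p (Suc N)) * pbin p N j + p (Suc N) * (case j of 0 \<Rightarrow> 0 | Suc i \<Rightarrow> pbin p N i)"

definition less_prob :: "(nat \<Rightarrow> real) \<Rightarrow> nat \<Rightarrow> nat \<Rightarrow> real" where
  "less_prob p N k = (\<Sum>j<k. pbin p N j)"

definition capped_mean :: "(nat \<Rightarrow> real) \<Rightarrow> nat \<Rightarrow> nat \<Rightarrow> real" where
  "capped_mean p N k = (\<Sum>i<N. p (Suc i) * less_prob p i k)"

lemma pbin_nonneg:
  assumes "\<And>i. 1 \<le> i \<Longrightarrow> i \<le> N \<Longrightarrow> 0 \<le> p i \<and> p i \<le> 1"
  shows "0 \<le> pbin p N j"
  using assms
proof (induction N arbitrary: j)
  case (Suc N)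
  have "0 \<le> pbin p N i" for i using Suc by auto
  moreover have "0 \<le> p (Suc N) \<and> p (Suc N) \<le> 1" using Suc.prems[of "Suc N"] by auto
  ultimately show ?case by (auto split: nat.split)
qed auto

lemma pbin_eq_0: "N < j \<Longrightarrow> pbin p N j = 0"
  by (induction N arbitrary: j) (auto split: nat.split)

lemma pbin_cong:
  assumes "\<And>i. 1 \<le> i \<Longrightarrow> i \<le> N \<Longrightarrow> p i = q i"
  shows "pbin p N j = pbin q N j"
  using assms by (induction N arbitrary: j) (auto split: nat.split)

lemma less_prob_0 [simp]: "less_prob p N 0 = 0"
  by (simp add: less_prob_def)

lemma less_prob_base: "less_prob p 0 k = of_bool (k > 0)"
  unfolding less_prob_def by (cases k) (simp_all add: sum.lessThan_Suc_shift del: sum.lessThan_Suc)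

lemma less_prob_Suc: "less_prob p N (Suc k) = less_prob p N k + pbin p N k"
  by (simp add: less_prob_def)

lemma less_prob_Suc_Suc:
  "less_prob p (Suc N) (Suc k) =
     (1 - p (Suc N)) * less_prob p N (Suc k) + p (Suc N) * less_prob p N k"
  by (induction k) (auto simp: less_prob_def algebra_simps)

lemma less_prob_step:
  assumes "k \<ge> 1"
  shows "less_prob p (Suc N) k = less_prob p N k - p (Suc N) * pbin p N (k - 1)"
proof -
  obtain k' where "k = Suc k'" using assms by (cases k) auto
  thus ?thesis using less_prob_Suc_Suc[of p N k'] by (simp add: less_prob_Suc algebra_simps)
qed

lemma less_prob_cong:
  assumes "\<And>i. 1 \<le> i \<Longrightarrow> i \<le> N \<Longrightarrow> p i = q i"
  shows "less_prob p N k = less_prob q N k"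
  unfolding less_prob_def using assms by (intro sum.cong refl pbin_cong) auto

lemma less_prob_nonneg:
  assumes "\<And>i. 1 \<le> i \<Longrightarrow> i \<le> N \<Longrightarrow> 0 \<le> p i \<and> p i \<le> 1"
  shows "0 \<le> less_prob p N k"
  unfolding less_prob_def using assms by (intro sum_nonneg pbin_nonneg) auto

lemma less_prob_antimono:
  assumes "\<And>i. 1 \<le> i \<Longrightarrow> i \<le> N \<Longrightarrow> 0 \<le> p i \<and> p i \<le> 1" and "M \<le> N"
  shows "less_prob p N k \<le> less_prob p M k"
  using \<open>M \<le> N\<close> assms(1)
proof (induction N rule: dec_induct)
  case (step N)
  have "less_prob p (Suc N) k \<le> less_prob p N k"
  proof (cases k)
    case (Suc k')
    have "0 \<le> p (Suc N) * pbin p N (k - 1)"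
      using step.prems[of "Suc N"] step.prems by (intro mult_nonneg_nonneg pbin_nonneg) auto
    thus ?thesis using less_prob_step[of k p N] Suc by auto
  qed simp
  also have "\<dots> \<le> less_prob p M k" using step by auto
  finally show ?case .
qed simp

lemma less_prob_le_1:
  assumes "\<And>i. 1 \<le> i \<Longrightarrow> i \<le> N \<Longrightarrow> 0 \<le> p i \<and> p i \<le> 1"
  shows "less_prob p N k \<le> 1"
  using less_prob_antimono[of N p 0 k] assms by (cases k) (auto simp: less_prob_base)

lemma less_prob_eq_1: "N < k \<Longrightarrow> less_prob p N k = 1"
proof (induction N arbitrary: k)
  case (Suc N)
  thus ?case by (cases k) (auto simp: less_prob_Suc_Suc)
qed (simp add: less_prob_base)

lemma capped_mean_Suc:
  "capped_mean p (Suc N) k = capped_mean p N k + p (Suc N) * less_prob p N k"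
  by (simp add: capped_mean_def)

text \<open>\<open>capped_mean\<close> adds the increments of \<open>min S k\<close> agent by agent;
  this is the tail-sum form, \<open>P(S > i)\<close> summed over \<open>i < k\<close>. By
  \<open>less_prob_step\<close> each agent changes both sides equally.\<close>

lemma capped_mean_eq: "capped_mean p N k = real k - (\<Sum>i<k. less_prob p N (Suc i))"
proof (induction N)
  case 0
  show ?case by (simp add: capped_mean_def less_prob_base)
next
  case (Suc N)
  have "(\<Sum>i<k. less_prob p (Suc N) (Suc i))
      = (\<Sum>i<k. less_prob p N (Suc i) - p (Suc N) * pbin p N i)"
    by (intro sum.cong refl) (simp add: less_prob_step)
  also have "\<dots> = (\<Sum>i<k. less_prob p N (Suc i)) - p (Suc N) * less_prob p N k"
    by (simp add: sum_subtractf less_prob_def sum_distrib_left)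
  finally show ?case using Suc by (simp add: capped_mean_Suc)
qed

lemma capped_mean_cong:
  assumes "\<And>i. 1 \<le> i \<Longrightarrow> i \<le> N \<Longrightarrow> p i = q i"
  shows "capped_mean p N k = capped_mean q N k"
  unfolding capped_mean_eq using less_prob_cong[OF assms] by simp

lemma continuous_pbin:
  assumes "\<And>i. continuous_on A (\<lambda>t. p t i)"
  shows "continuous_on A (\<lambda>t. pbin (p t) N j)"
proof (induction N arbitrary: j)
  case (Suc N)
  show ?case
    by (cases j) (auto intro!: continuous_intros Suc assms)
qed auto

lemma continuous_less_prob:
  assumes "\<And>i. continuous_on A (\<lambda>t. p t i)"
  shows "continuous_on A (\<lambda>t. less_prob (p t) N k)"
  unfolding less_prob_def by (intro continuous_intros continuous_pbin assms)

lemma continuous_capped_mean: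
  assumes "\<And>i. continuous_on A (\<lambda>t. p t i)"
  shows "continuous_on A (\<lambda>t. capped_mean (p t) N k)"
  unfolding capped_mean_def by (intro continuous_intros continuous_less_prob assms)

lemma pbin_all_one:
  "(\<And>i. 1 \<le> i \<Longrightarrow> i \<le> N \<Longrightarrow> p i = 1) \<Longrightarrow> pbin p N j = of_bool (j = N)"
  by (induction N arbitrary: j) (auto split: nat.split)

lemma less_prob_all_one:
  assumes "\<And>i. 1 \<le> i \<Longrightarrow> i \<le> N \<Longrightarrow> p i = 1" "k \<le> N"
  shows "less_prob p N k = 0"
  unfolding less_prob_def using assms(2) pbin_all_one[OF assms(1)] by (auto intro!: sum.neutral)

lemma capped_mean_all_one:
  assumes "\<And>i. 1 \<le> i \<Longrightarrow> i \<le> N \<Longrightarrow> p i = 1" "k \<le> N"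
  shows "capped_mean p N k = real k"
  unfolding capped_mean_eq using assms by (auto intro!: sum.neutral less_prob_all_one)

section \<open>Identical probabilities: mass function, derivatives and likelihood ratio of the
  binomial law\<close>

abbreviation binpr :: "nat \<Rightarrow> real \<Rightarrow> nat \<Rightarrow> real" where
  "binpr N t \<equiv> pbin (\<lambda>_. t) N"

lemma binpr_eq: "j \<le> N \<Longrightarrow> binpr N t j = real (N choose j) * t ^ j * (1 - t) ^ (N - j)"
proof (induction N arbitrary: j)
  case (Suc N)
  show ?case
  proof (cases j)
    case 0
    thus ?thesis using Suc.IH[of 0] by simp
  next
    case (Suc i)
    hence i: "i \<le> N" using Suc.prems by simp
    show ?thesis
    proof (cases "i = N")
      case True
      thus ?thesis using Suc Suc.IH[of N] pbin_eq_0[of N "Suc N"] by simp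
    next
      case False
      then obtain d where d: "N = Suc i + d" using i less_eqE[of "Suc i" N] by force
      have "binpr N t i = real (N choose i) * t ^ i * (1 - t) ^ Suc d"
        using Suc.IH[of i] d by simp
      moreover have "binpr N t (Suc i) = real (N choose Suc i) * t ^ Suc i * (1 - t) ^ d"
        using Suc.IH[of "Suc i"] d by simp
      moreover have "binpr (Suc N) t j = (1 - t) * binpr N t (Suc i) + t * binpr N t i"
        by (simp add: Suc)
      ultimately have "binpr (Suc N) t j = (1 - t) * (real (N choose Suc i) * t ^ Suc i * (1 - t) ^ d)
          + t * (real (N choose i) * t ^ i * (1 - t) ^ Suc d)" by (simp only:)
      hence "binpr (Suc N) t j =
          (real (N choose i) + real (N choose Suc i)) * t ^ Suc i * (1 - t) ^ Suc d"
        by (simp add: algebra_simps)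
      thus ?thesis using Suc d by simp
    qed
  qed
qed simp

text \<open>Raising one success probability lowers \<open>P(S < k)\<close> at the rate of the
  probability that the other \<open>M\<close> trials give \<open>k - 1\<close>, and the
  \<open>Suc M\<close> trials contribute equally. The induction checks this through the
  recursion.\<close>

lemma DERIV_less_prob_binomial:
  assumes "k \<ge> 1"
  shows "((\<lambda>t. less_prob (\<lambda>_. t) (Suc M) k) has_real_derivative
            - (real (Suc M) * binpr M t (k - 1))) (at t)"
  using assms
proof (induction M arbitrary: k)
  case 0
  have "less_prob (\<lambda>_. t) (Suc 0) k = 1 - t * of_bool (k = 1)" for t
    using less_prob_step[OF 0, of "\<lambda>_. t" 0] 0 by (auto simp: less_prob_base)
  thus ?case using 0 by (auto intro!: derivative_eq_intros)
next
  case (Suc M)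
  obtain k' where k: "k = Suc k'" using Suc.prems by (cases k) auto
  have eq: "less_prob (\<lambda>_. t) (Suc (Suc M)) k =
     (1 - t) * less_prob (\<lambda>_. t) (Suc M) (Suc k') + t * less_prob (\<lambda>_. t) (Suc M) k'" for t
    unfolding k by (rule less_prob_Suc_Suc)
  \<comment> \<open>For \<open>k' = 0\<close> the function is identically 0 and the induction
    hypothesis does not apply.\<close>
  have d0: "((\<lambda>t. less_prob (\<lambda>_. t) (Suc M) k') has_real_derivative
      - (real (Suc M) * (if k' = 0 then 0 else binpr M t (k' - 1)))) (at t)"
    using Suc.IH[of k'] by (cases "k' = 0") auto
  have "((\<lambda>t. less_prob (\<lambda>_. t) (Suc (Suc M)) k) has_real_derivative
     - less_prob (\<lambda>_. t) (Suc M) (Suc k')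
     - (1 - t) * (real (Suc M) * binpr M t k')
     + less_prob (\<lambda>_. t) (Suc M) k'
     - t * (real (Suc M) * (if k' = 0 then 0 else binpr M t (k' - 1)))) (at t)"
    unfolding eq using Suc.IH[of "Suc k'"] d0
    by (auto intro!: derivative_eq_intros simp: algebra_simps)
  moreover have "- less_prob (\<lambda>_. t) (Suc M) (Suc k')
     - (1 - t) * (real (Suc M) * binpr M t k')
     + less_prob (\<lambda>_. t) (Suc M) k'
     - t * (real (Suc M) * (if k' = 0 then 0 else binpr M t (k' - 1)))
     = - (real (Suc (Suc M)) * binpr (Suc M) t (k - 1))"
    unfolding k less_prob_Suc by (cases k') (simp_all add: algebra_simps)
  ultimately show ?case by simp
qed

lemma DERIV_capped_mean_binomial:
  "((\<lambda>t. capped_mean (\<lambda>_. t) (Suc M) k) has_real_derivative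
      real (Suc M) * less_prob (\<lambda>_. t) M k) (at t)"
proof -
  have "((\<lambda>t. real k - (\<Sum>i<k. less_prob (\<lambda>_. t) (Suc M) (Suc i))) has_real_derivative
      0 - (\<Sum>i<k. - (real (Suc M) * binpr M t (Suc i - 1)))) (at t)"
    by (intro derivative_intros DERIV_less_prob_binomial) simp
  thus ?thesis unfolding capped_mean_eq less_prob_def[of _ M k]
    by (simp add: sum_negf sum_distrib_left)
qed

text \<open>The mass ratio at \<open>l\<close> between \<open>s\<close> and \<open>t\<close> is a
  constant times the \<open>l\<close>-th power of the odds ratio
  \<open>s (1 - t) / (t (1 - s)) \<ge> 1\<close>. The cross-multiplied form covers
  \<open>t = 0\<close> and \<open>s = 1\<close>.\<close>

lemma binomial_likelihood_ratio:
  fixes s t :: real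
  assumes "0 \<le> t" "t \<le> s" "s \<le> 1" "l \<le> M" "j \<le> l"
  shows "binpr M t l * binpr M s j \<le> binpr M s l * binpr M t j"
proof -
  obtain d where d: "l = j + d" using assms(5) less_eqE by blast
  obtain e where e: "M = j + d + e" using assms(4) d less_eqE by blast
  have "t * (1 - s) \<le> s * (1 - t)" "0 \<le> t * (1 - s)"
    using assms by (auto simp: algebra_simps intro: mult_left_le_one_le)
  hence "(t * (1 - s)) ^ d \<le> (s * (1 - t)) ^ d"
    by (intro power_mono)
  hence "(real (M choose l) * real (M choose j) * (t * s) ^ j * ((1 - t) * (1 - s)) ^ e)
         * (t * (1 - s)) ^ d
      \<le> (real (M choose l) * real (M choose j) * (t * s) ^ j * ((1 - t) * (1 - s)) ^ e)
         * (s * (1 - t)) ^ d"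
    using assms by (intro mult_left_mono mult_nonneg_nonneg zero_le_power) auto
  thus ?thesis using d e
    by (simp add: binpr_eq power_add power_mult_distrib mult_ac)
qed

subsection \<open>Comparison with the binomial distribution\<close>

text \<open>Inductive step for Newton's inequalities: \<open>u0\<close>, ..., \<open>u3\<close> are
  consecutive normalised masses, and the three brackets are, up to a common factor, consecutive ones
  after one more trial. At the ends of the range \<open>u0\<close> or \<open>u3\<close> is a filler
  with coefficient 0, hence the conditional hypotheses.\<close>

lemma log_concave_step:
  fixes u :: "nat \<Rightarrow> real" and \<alpha> \<beta> a b :: real
  assumes "0 < \<alpha>" "0 < \<beta>" "1 \<le> a" "1 \<le> b"
    and pos: "0 < u0" "0 < u1" "0 < u2" "0 < u3"
    and lo: "b > 1 \<Longrightarrow> u0 * u2 \<le> u1\<^sup>2" and hi: "a > 1 \<Longrightarrow> u1 * u3 \<le> u2\<^sup>2"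
  shows "((a + 1) * \<alpha> * u1 + (b - 1) * \<beta> * u0) * ((a - 1) * \<alpha> * u3 + (b + 1) * \<beta> * u2)
       \<le> (a * \<alpha> * u2 + b * \<beta> * u1)\<^sup>2"
proof -
  have h1: "(a\<^sup>2 - 1) * (u1 * u3) \<le> (a\<^sup>2 - 1) * u2\<^sup>2"
    using hi assms(3) by (cases "a = 1") (auto intro!: mult_left_mono)
  have h2: "(b\<^sup>2 - 1) * (u0 * u2) \<le> (b\<^sup>2 - 1) * u1\<^sup>2"
    using lo assms(4) by (cases "b = 1") (auto intro!: mult_left_mono)
  \<comment> \<open>Multiplying the two log-concavity hypotheses and cancelling
    \<open>u1 * u2\<close> compares the outer product with the inner one.\<close>
  have h3: "((a - 1) * (b - 1)) * (u0 * u3) \<le> ((a - 1) * (b - 1)) * (u1 * u2)"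
  proof (cases "a = 1 \<or> b = 1")
    case False
    hence "a > 1" "b > 1" using assms by auto
    hence "(u0 * u2) * (u1 * u3) \<le> u1\<^sup>2 * u2\<^sup>2"
      using lo hi pos by (intro mult_mono) auto
    hence "(u0 * u3) * (u1 * u2) \<le> (u1 * u2) * (u1 * u2)"
      by (simp add: power2_eq_square mult_ac)
    hence "u0 * u3 \<le> u1 * u2" using pos by (simp add: mult_le_cancel_right)
    thus ?thesis using assms by (intro mult_left_mono) auto
  qed auto
  have "(a * \<alpha> * u2 + b * \<beta> * u1)\<^sup>2
      - ((a + 1) * \<alpha> * u1 + (b - 1) * \<beta> * u0) * ((a - 1) * \<alpha> * u3 + (b + 1) * \<beta> * u2)
      = \<alpha>\<^sup>2 * ((a\<^sup>2 - 1) * u2\<^sup>2 - (a\<^sup>2 - 1) * (u1 * u3))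
      + \<beta>\<^sup>2 * ((b\<^sup>2 - 1) * u1\<^sup>2 - (b\<^sup>2 - 1) * (u0 * u2))
      + \<alpha> * \<beta> * (((a - 1) * (b - 1)) * (u1 * u2) - ((a - 1) * (b - 1)) * (u0 * u3))
      + (\<alpha> * u2 - \<beta> * u1)\<^sup>2"
    by (simp add: power2_eq_square algebra_simps)
  also have "\<dots> \<ge> 0"
    using h1 h2 h3 assms by (intro add_nonneg_nonneg mult_nonneg_nonneg) auto
  finally show ?thesis by simp
qed

text \<open>Newton's inequalities for the Poisson binomial distribution.\<close>

lemma pbin_ultra_log_concave:
  assumes "\<And>i. 1 \<le> i \<Longrightarrow> i \<le> N \<Longrightarrow> 0 < p i \<and> p i < 1"
  shows "\<exists>u. (\<forall>j\<le>N. pbin p N j = real (N choose j) * u j \<and> 0 < u j) \<and>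
             (\<forall>j. j + 2 \<le> N \<longrightarrow> u j * u (j + 2) \<le> (u (j + 1))\<^sup>2)"
  using assms
proof (induction N)
  case 0
  show ?case by (rule exI[of _ "\<lambda>_. 1"]) auto
next
  case (Suc N)
  then obtain v where v: "\<And>j. j \<le> N \<Longrightarrow> pbin p N j = real (N choose j) * v j \<and> 0 < v j"
     "\<And>j. j + 2 \<le> N \<Longrightarrow> v j * v (j + 2) \<le> (v (j + 1))\<^sup>2" by (metis le_Suc_eq)
  \<comment> \<open>Filling with 1 beyond \<open>N\<close> keeps positivity at every index; those
    values only meet zero coefficients.\<close>
  define u where "u = (\<lambda>j. if j \<le> N then v j else 1)"
  have u: "\<And>j. j \<le> N \<Longrightarrow> pbin p N j = real (N choose j) * u j" "\<And>j. 0 < u j"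
     "\<And>j. j + 2 \<le> N \<Longrightarrow> u j * u (j + 2) \<le> (u (j + 1))\<^sup>2"
    using v by (auto simp: u_def)
  define q where "q = p (Suc N)"
  have q: "0 < q" "q < 1" using Suc.prems[of "Suc N"] by (auto simp: q_def)
  \<comment> \<open>\<open>w\<close> is the new normalised mass times \<open>Suc N\<close>: the
    absorption identities turn both terms of the recursion into multiples of
    \<open>Suc N choose j\<close>. At \<open>j = 0\<close> the truncated index \<open>j - 1\<close>
    has coefficient 0.\<close>
  define w where "w = (\<lambda>j. (real (Suc N) - real j) * (1 - q) * u j + real j * q * u (j - 1))"
  have eq: "pbin p (Suc N) j = real (Suc N choose j) * (w j / real (Suc N))" if "j \<le> Suc N" for j
  proof -
    have 1: "real (Suc N choose j) * (real (Suc N) - real j) = real (Suc N) * real (N choose j)"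
    proof (cases "j = Suc N")
      case False
      hence "(Suc N - j) * (Suc N choose j) = Suc N * (N choose j)"
        using that binomial_absorb_comp[of "Suc N" j] by simp
      hence "real ((Suc N - j) * (Suc N choose j)) = real (Suc N * (N choose j))" by simp
      thus ?thesis using that by (simp only: of_nat_mult of_nat_diff mult_ac)
    qed simp
    show ?thesis
    proof (cases j)
      case 0
      thus ?thesis by (simp add: w_def u q_def)
    next
      case (Suc i)
      have "Suc i * (Suc N choose Suc i) = Suc N * (N choose i)"
        by (rule Suc_times_binomial)
      hence "real (Suc i * (Suc N choose Suc i)) = real (Suc N * (N choose i))" by (simp only:)
      hence 2: "real (Suc N choose j) * real j = real (Suc N) * real (N choose i)"
        unfolding Suc by (simp only: of_nat_mult mult.commute)
      have "real (Suc N choose j) * w j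
         = (real (Suc N choose j) * (real (Suc N) - real j)) * ((1 - q) * u j)
         + (real (Suc N choose j) * real j) * (q * u i)"
        unfolding w_def by (simp add: Suc algebra_simps)
      hence "real (Suc N choose j) * w j
         = real (Suc N) * ((1 - q) * (real (N choose j) * u j) + q * (real (N choose i) * u i))"
        unfolding 1 2 by (simp only: distrib_left mult_ac)
      moreover have "pbin p N j = real (N choose j) * u j"
        using u(1)[of j] pbin_eq_0[of N j p] by (cases "j \<le> N") auto
      moreover have "pbin p N i = real (N choose i) * u i" using that Suc u(1) by auto
      ultimately have "real (Suc N choose j) * w j = real (Suc N) * pbin p (Suc N) j"
        using Suc by (simp add: q_def)
      thus ?thesis by (simp add: field_simps)
    qed
  qed
  have pos: "0 < w j" if "j \<le> Suc N" for j
  proof (cases "j = Suc N")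
    case False
    thus ?thesis unfolding w_def using that q u(2)[of j] u(2)[of "j-1"]
      by (intro add_pos_nonneg mult_pos_pos mult_nonneg_nonneg) auto
  qed (use q u(2) in \<open>auto simp: w_def\<close>)
  have lc: "w j * w (j + 2) \<le> (w (j + 1))\<^sup>2" if "j + 2 \<le> Suc N" for j
  proof -
    define a where "a = real (Suc N) - real (j + 1)"
    define b where "b = real (j + 1)"
    have w: "w j = (a + 1) * (1 - q) * u j + (b - 1) * q * u (j - 1)"
      "w (j + 1) = a * (1 - q) * u (j + 1) + b * q * u j"
      "w (j + 2) = (a - 1) * (1 - q) * u (j + 2) + (b + 1) * q * u (j + 1)"
      by (simp_all add: w_def a_def b_def algebra_simps)
    have "((a + 1) * (1 - q) * u j + (b - 1) * q * u (j - 1))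
        * ((a - 1) * (1 - q) * u (j + 2) + (b + 1) * q * u (j + 1))
       \<le> (a * (1 - q) * u (j + 1) + b * q * u j)\<^sup>2"
    proof (rule log_concave_step)
      show "u (j - 1) * u (j + 1) \<le> (u j)\<^sup>2" if "b > 1"
        using that u(3)[of "j - 1"] \<open>j + 2 \<le> Suc N\<close> by (cases j) (auto simp: b_def)
      show "u j * u (j + 2) \<le> (u (j + 1))\<^sup>2" if "a > 1"
        using that u(3)[of j] by (auto simp: a_def)
    qed (use q u(2) that in \<open>auto simp: a_def b_def\<close>)
    thus ?thesis unfolding w .
  qed
  show ?case
  proof (rule exI[of _ "\<lambda>j. w j / real (Suc N)"], intro conjI allI impI)
    fix j assume "j + 2 \<le> Suc N"
    from divide_right_mono[OF lc[OF this], of "(real (Suc N))\<^sup>2"]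
    show "w j / real (Suc N) * (w (j + 2) / real (Suc N)) \<le> (w (j + 1) / real (Suc N))\<^sup>2"
      by (simp add: power_divide power2_eq_square)
  qed (use eq pos in auto)
qed

text \<open>By log-concavity the ratios of consecutive terms do not increase, so a single descent
  persists up to \<open>N\<close>; a drop from \<open>i\<close> to \<open>l\<close> contains a
  descent.\<close>

lemma log_concave_unimodal:
  fixes r :: "nat \<Rightarrow> real"
  assumes pos: "\<And>j. j \<le> N \<Longrightarrow> 0 < r j"
    and lc: "\<And>j. j + 2 \<le> N \<Longrightarrow> r j * r (j + 2) \<le> (r (j + 1))\<^sup>2"
    and "i < l" "l \<le> j" "j \<le> N" "r l < r i"
  shows "r j \<le> r l"
proof -
  have desc: "r (Suc j') < r j'" if "s \<le> j'" "Suc j' \<le> N" "r (Suc s) < r s" for s j'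
    using that
  proof (induction j' rule: dec_induct)
    case (step m)
    have "r (m + 2) * r m \<le> r (m + 1) * r (m + 1)"
      using lc[of m] step.prems by (simp add: power2_eq_square mult_ac)
    also have "\<dots> < r (m + 1) * r m"
      using step.IH step.prems pos[of "Suc m"] by (intro mult_strict_left_mono) auto
    finally show ?case using pos[of m] step.prems by (simp add: mult_less_cancel_right)
  qed
  have "\<exists>s. i \<le> s \<and> s < l \<and> r (Suc s) < r s"
  proof (rule ccontr)
    assume "\<not> ?thesis"
    hence up: "\<And>s. i \<le> s \<Longrightarrow> s < l \<Longrightarrow> r s \<le> r (Suc s)" by force
    have "r i \<le> r l" using \<open>i < l\<close>[THEN less_imp_le] up
    proof (induction l rule: dec_induct)
      case (step m)
      have "r i \<le> r m" using step.prems by (intro step.IH) auto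
      also have "\<dots> \<le> r (Suc m)" using step by auto
      finally show ?case .
    qed simp
    thus False using \<open>r l < r i\<close> by simp
  qed
  then obtain s where s: "i \<le> s" "s < l" "r (Suc s) < r s" by blast
  show ?thesis using \<open>l \<le> j\<close> \<open>j \<le> N\<close>
  proof (induction j rule: dec_induct)
    case (step m)
    thus ?case using desc[of s m] s by auto
  qed simp
qed

lemma less_prob_concat:
  assumes "i \<le> k"
  shows "less_prob p N k = less_prob p N i + (\<Sum>j=i..<k. pbin p N j)"
  using sum.atLeastLessThan_concat[of 0 i k "pbin p N"] assms
  by (simp only: less_prob_def lessThan_atLeast0)

text \<open>
  The ratio of the two mass functions is log-concave, hence unimodal: if it exceeded 1 below \<open>i\<close> and
  were less than 1 in \<open>{i..<k}\<close>, it would stay below 1 on \<open>{k..N}\<close>, where both masses agree.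
\<close>

lemma less_prob_le_binomial:
  assumes p: "\<And>i. 1 \<le> i \<Longrightarrow> i \<le> N \<Longrightarrow> 0 < p i \<and> p i < 1"
    and t: "0 < t" "t < 1" and "k \<le> N" "i < k"
    and eq: "less_prob p N k = less_prob (\<lambda>_. t) N k"
  shows "less_prob p N i \<le> less_prob (\<lambda>_. t) N i"
proof (rule ccontr)
  assume gt: "\<not> ?thesis"
  obtain u where u: "\<And>j. j \<le> N \<Longrightarrow> pbin p N j = real (N choose j) * u j"
     "\<And>j. j \<le> N \<Longrightarrow> 0 < u j"
     "\<And>j. j + 2 \<le> N \<Longrightarrow> u j * u (j + 2) \<le> (u (j + 1))\<^sup>2"
    using pbin_ultra_log_concave[of N p] p by blast
  \<comment> \<open>\<open>c\<close> is the binomial mass without its coefficient, a geometric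
    sequence in \<open>j\<close>; dividing by it preserves log-concavity and makes \<open>r\<close>
    the ratio of the two masses.\<close>
  define c where "c = (\<lambda>j. t ^ j * (1 - t) ^ (N - j))"
  define r where "r = (\<lambda>j. u j / c j)"
  have c: "0 < c j" for j using t by (simp add: c_def)
  have b: "binpr N t j = real (N choose j) * c j" if "j \<le> N" for j
    using that by (simp add: binpr_eq c_def)
  have cc: "c j * c (j + 2) = (c (j + 1))\<^sup>2" if j: "j + 2 \<le> N" for j
  proof -
    obtain d where d: "N = j + 2 + d" using le_Suc_ex[OF j] by auto
    have "N - j = d + 2" "N - (j + 2) = d" "N - (j + 1) = d + 1" using d by auto
    thus ?thesis by (simp only: c_def power2_eq_square power_add mult_ac)
        (simp add: mult_ac power2_eq_square)
  qed
  have rpos: "0 < r j" if "j \<le> N" for j using u(2) c that by (simp add: r_def)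
  have rlc: "r j * r (j + 2) \<le> (r (j + 1))\<^sup>2" if "j + 2 \<le> N" for j
  proof -
    have "u j * u (j + 2) / (c j * c (j + 2)) \<le> (u (j + 1))\<^sup>2 / (c j * c (j + 2))"
      using u(3)[OF that] c[of j] c[of "j + 2"] by (intro divide_right_mono) auto
    also have "\<dots> = (r (j + 1))\<^sup>2" unfolding cc[OF that] r_def by (simp add: power_divide)
    finally show ?thesis by (simp add: r_def)
  qed
  have lt: "binpr N t j < pbin p N j \<longleftrightarrow> 1 < r j" "pbin p N j < binpr N t j \<longleftrightarrow> r j < 1"
    if "j \<le> N" for j
    using that c[of j] u(1)[OF that] b[OF that]
    by (auto simp: r_def mult_less_cancel_left_pos)
  have "\<exists>a<i. binpr N t a < pbin p N a"
  proof (rule ccontr)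
    assume "\<not> ?thesis"
    hence "less_prob p N i \<le> less_prob (\<lambda>_. t) N i"
      unfolding less_prob_def by (intro sum_mono) force
    thus False using gt by simp
  qed
  then obtain a where a: "a < i" "1 < r a" using lt(1) \<open>i < k\<close> \<open>k \<le> N\<close> by force
  \<comment> \<open>The excess below \<open>i\<close> must be compensated in \<open>{i..<k}\<close>,
    because the two laws agree on the total below \<open>k\<close>.\<close>
  have "\<exists>l\<in>{i..<k}. pbin p N l < binpr N t l"
  proof (rule ccontr)
    assume "\<not> ?thesis"
    hence "(\<Sum>j=i..<k. binpr N t j) \<le> (\<Sum>j=i..<k. pbin p N j)"
      by (intro sum_mono) force
    thus False using gt eq less_prob_concat[of i k _ N] \<open>i < k\<close>
      by (metis add_less_le_mono less_imp_le less_irrefl not_le)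
  qed
  then obtain l where l: "i \<le> l" "l < k" "r l < 1" using lt(2) \<open>k \<le> N\<close> by force
  have "pbin p N j < binpr N t j" if "j \<in> {k..N}" for j
  proof -
    have "r j \<le> r l"
      by (rule log_concave_unimodal[OF rpos rlc, of N a]) (use a l that \<open>i < k\<close> in auto)
    thus ?thesis using l lt(2)[of j] that by auto
  qed
  hence "(\<Sum>j=k..<Suc N. pbin p N j) < (\<Sum>j=k..<Suc N. binpr N t j)"
    using \<open>k \<le> N\<close> by (intro sum_strict_mono) auto
  thus False
    using eq less_prob_concat[of k "Suc N" p N] less_prob_concat[of k "Suc N" "\<lambda>_. t" N] \<open>k \<le> N\<close>
    by (simp add: less_prob_eq_1)
qed

text \<open>In the tail-sum form every \<open>P(S \<le> i)\<close> with \<open>i < k\<close> is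
  dominated by the binomial one; for \<open>i = k - 1\<close> they are equal by hypothesis.\<close>

lemma capped_mean_ge_binomial:
  assumes p: "\<And>i. 1 \<le> i \<Longrightarrow> i \<le> N \<Longrightarrow> 0 < p i \<and> p i < 1"
    and t: "0 < t" "t < 1" and "k \<le> N"
    and eq: "less_prob p N k = less_prob (\<lambda>_. t) N k"
  shows "capped_mean (\<lambda>_. t) N k \<le> capped_mean p N k"
proof -
  have "less_prob p N (Suc i) \<le> less_prob (\<lambda>_. t) N (Suc i)" if "i < k" for i
    using less_prob_le_binomial[OF p t \<open>k \<le> N\<close> _ eq, of "Suc i"] eq that
    by (cases "Suc i = k") auto
  thus ?thesis unfolding capped_mean_eq by (auto intro!: sum_mono)
qed

subsection \<open>The balanced binomial distribution\<close>

lemma less_prob_binomial_antimono: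
  assumes "0 \<le> s" "s \<le> t" "t \<le> 1" "k \<ge> 1"
  shows "less_prob (\<lambda>_. t) (Suc M) k \<le> less_prob (\<lambda>_. s) (Suc M) k"
proof (rule DERIV_nonpos_imp_nonincreasing[OF \<open>s \<le> t\<close>])
  fix x assume "s \<le> x" "x \<le> t"
  hence "0 \<le> binpr M x (k - 1)" using assms by (intro pbin_nonneg) auto
  thus "\<exists>y. ((\<lambda>t. less_prob (\<lambda>_. t) (Suc M) k) has_real_derivative y) (at x) \<and> y \<le> 0"
    using DERIV_less_prob_binomial[OF \<open>k \<ge> 1\<close>] by (intro exI conjI) auto
qed

lemma capped_mean_binomial_mono:
  assumes "0 \<le> s" "s \<le> t" "t \<le> 1"
  shows "capped_mean (\<lambda>_. s) (Suc M) k \<le> capped_mean (\<lambda>_. t) (Suc M) k"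
proof (rule DERIV_nonneg_imp_nondecreasing[OF \<open>s \<le> t\<close>])
  fix x assume "s \<le> x" "x \<le> t"
  hence "0 \<le> real (Suc M) * less_prob (\<lambda>_. x) M k"
    using assms by (intro mult_nonneg_nonneg less_prob_nonneg) auto
  thus "\<exists>y. ((\<lambda>t. capped_mean (\<lambda>_. t) (Suc M) k) has_real_derivative y) (at x) \<and> 0 \<le> y"
    using DERIV_capped_mean_binomial by blast
qed

lemma less_prob_all_zero:
  assumes "\<And>i. 1 \<le> i \<Longrightarrow> i \<le> N \<Longrightarrow> p i = 0" "k \<ge> 1"
  shows "less_prob p N k = 1"
  using assms by (induction N) (auto simp: less_prob_base less_prob_step)

lemma capped_mean_all_zero:
  assumes "\<And>i. 1 \<le> i \<Longrightarrow> i \<le> N \<Longrightarrow> p i = 0"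
  shows "capped_mean p N k = 0"
  using assms by (simp add: capped_mean_def)

text \<open>This point provides the common value. At \<open>t = 0\<close> no unit is sold and at
  \<open>t = 1\<close> all \<open>k\<close> are, so the difference vanishes strictly in
  between.\<close>

lemma binomial_balance_point:
  assumes "1 \<le> k" "k \<le> N"
  obtains t where "0 < t" "t < 1" "capped_mean (\<lambda>_. t) N k = real k * less_prob (\<lambda>_. t) N k"
proof -
  let ?h = "\<lambda>t. capped_mean (\<lambda>_. t) N k - real k * less_prob (\<lambda>_. t) N k"
  have ends: "?h 0 < 0" "0 < ?h 1"
    using assms by (simp_all add: less_prob_all_zero capped_mean_all_zero
        less_prob_all_one capped_mean_all_one)
  have "\<exists>t\<ge>0. t \<le> 1 \<and> ?h t = 0"
    by (rule IVT') (use ends in \<open>auto intro!: continuous_intros continuous_less_prob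
        continuous_capped_mean\<close>)
  then obtain t where t: "0 \<le> t" "t \<le> 1" "?h t = 0" by blast
  moreover have "t \<noteq> 0" "t \<noteq> 1" using t(3) ends by auto
  ultimately show ?thesis by (intro that[of t]) auto
qed

text \<open>
  The weight \<open>a\<close> makes the derivative of the mixture vanish at \<open>s\<close>; by monotonicity of the binomial
  likelihood ratio this derivative is nonnegative before \<open>s\<close> and nonpositive after it.
\<close>

lemma binomial_mixture_max:
  assumes "1 \<le> k" "k \<le> Suc M" and s: "0 < s" "s < 1"
  obtains a where "0 \<le> a" "a \<le> 1"
    "\<And>t. 0 \<le> t \<Longrightarrow> t \<le> 1 \<Longrightarrow>
      a * less_prob (\<lambda>_. t) (Suc M) k + (1 - a) * capped_mean (\<lambda>_. t) (Suc M) k / real k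
      \<le> a * less_prob (\<lambda>_. s) (Suc M) k + (1 - a) * capped_mean (\<lambda>_. s) (Suc M) k / real k"
proof -
  \<comment> \<open>Up to the factor \<open>Suc M\<close>, \<open>B\<close> is minus the derivative
    of \<open>less_prob\<close> and \<open>C\<close> is the derivative of
    \<open>capped_mean\<close>.\<close>
  define B where "B = (\<lambda>t. binpr M t (k - 1))"
  define C where "C = (\<lambda>t. less_prob (\<lambda>_. t) M k)"
  define a where "a = C s / (C s + real k * B s)"
  define \<Phi> where "\<Phi> = (\<lambda>t. a * less_prob (\<lambda>_. t) (Suc M) k
      + (1 - a) * capped_mean (\<lambda>_. t) (Suc M) k / real k)"
  have B0: "0 \<le> B s" unfolding B_def using s by (intro pbin_nonneg) auto
  have "0 < binpr M s 0" using s by (simp add: binpr_eq)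
  also have "\<dots> \<le> C s"
    unfolding C_def less_prob_def using s assms(1)
    by (intro member_le_sum pbin_nonneg) auto
  finally have C0: "0 < C s" .
  have D: "0 < C s + real k * B s" using B0 C0 by (simp add: add_pos_nonneg)
  have a: "0 \<le> a" "a \<le> 1" using B0 C0 D by (auto simp: a_def)
  have a': "(1 - a) / real k = B s / (C s + real k * B s)"
  proof -
    have "1 - a = real k * B s / (C s + real k * B s)" using D by (simp add: a_def field_simps)
    thus ?thesis using assms(1) by simp
  qed
  have deriv: "(\<Phi> has_real_derivative
      real (Suc M) / (C s + real k * B s) * (B s * C t - C s * B t)) (at t)" for t
  proof -
    have "(\<Phi> has_real_derivative
       a * - (real (Suc M) * B t) + (1 - a) / real k * (real (Suc M) * C t)) (at t)"
      unfolding \<Phi>_def B_def C_def using assms(1)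
      by (auto intro!: derivative_eq_intros DERIV_less_prob_binomial DERIV_capped_mean_binomial)
    moreover have "a * - (real (Suc M) * B t) + (1 - a) / real k * (real (Suc M) * C t)
       = real (Suc M) / (C s + real k * B s) * (B s * C t - C s * B t)"
      unfolding a' unfolding a_def
      by (simp add: algebra_simps add_divide_distrib diff_divide_distrib)
    ultimately show ?thesis by simp
  qed
  \<comment> \<open>The likelihood ratio inequality with \<open>l = k - 1\<close>, summed over all
    \<open>j < k\<close>.\<close>
  have sgn: "B t' * C t \<ge> C t' * B t" if "0 \<le> t" "t \<le> t'" "t' \<le> 1" for t t'
  proof -
    have "(\<Sum>j<k. B t * binpr M t' j) \<le> (\<Sum>j<k. B t' * binpr M t j)"
      unfolding B_def
      by (intro sum_mono binomial_likelihood_ratio) (use that assms in auto)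
    thus ?thesis unfolding C_def less_prob_def by (simp add: sum_distrib_left mult.commute)
  qed
  have "\<Phi> t \<le> \<Phi> s" if t: "0 \<le> t" "t \<le> 1" for t
  proof (cases "t \<le> s")
    case True
    show ?thesis
    proof (rule DERIV_nonneg_imp_nondecreasing[OF True])
      fix x assume "t \<le> x" "x \<le> s"
      hence "0 \<le> real (Suc M) / (C s + real k * B s) * (B s * C x - C s * B x)"
        using sgn[of x s] t s D by (intro mult_nonneg_nonneg) auto
      thus "\<exists>y. (\<Phi> has_real_derivative y) (at x) \<and> 0 \<le> y" using deriv by blast
    qed
  next
    case False
    hence "s \<le> t" by simp
    thus ?thesis
    proof (rule DERIV_nonpos_imp_nonincreasing)
      fix x assume "s \<le> x" "x \<le> t"
      hence "real (Suc M) / (C s + real k * B s) * (B s * C x - C s * B x) \<le> 0"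
        using sgn[of s x] t s D by (intro mult_nonneg_nonpos) (auto simp: mult.commute)
      thus "\<exists>y. (\<Phi> has_real_derivative y) (at x) \<and> y \<le> 0" using deriv by blast
    qed
  qed
  thus ?thesis using a that unfolding \<Phi>_def by blast
qed

text \<open>If \<open>P(S < k)\<close> is below the balanced value, the binomial law with the same
  \<open>P(S < k)\<close> has success probability \<open>t \<ge> s\<close>; its capped mean is then
  at least the balanced one, and that of \<open>p\<close> is at least as large.\<close>

lemma max_ge_binomial_balance_interior:
  assumes "1 \<le> k" "k \<le> N" and p: "\<And>i. 1 \<le> i \<Longrightarrow> i \<le> N \<Longrightarrow> 0 < p i \<and> p i < 1"
    and s: "0 < s" "s < 1" "capped_mean (\<lambda>_. s) N k = real k * less_prob (\<lambda>_. s) N k"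
  shows "less_prob (\<lambda>_. s) N k \<le> max (less_prob p N k) (capped_mean p N k / real k)"
proof (cases "less_prob (\<lambda>_. s) N k \<le> less_prob p N k")
  case False
  obtain M where N: "N = Suc M" using assms(1,2) by (cases N) auto
  have "0 < pbin p N 0" using p by (induction N) auto
  also have "\<dots> \<le> less_prob p N k"
    unfolding less_prob_def using assms(1) p
    by (intro member_le_sum pbin_nonneg) (auto simp: less_imp_le)
  finally have pos: "0 < less_prob p N k" .
  have "less_prob (\<lambda>_. s) N k \<le> 1" using s by (intro less_prob_le_1) auto
  hence lt1: "less_prob p N k < 1" using False by simp
  have "\<exists>t\<ge>0. t \<le> 1 \<and> less_prob (\<lambda>_. t) N k = less_prob p N k"
    by (rule IVT2') (use assms(1,2) pos lt1 in
      \<open>auto simp: less_prob_all_zero less_prob_all_one intro!: continuous_less_prob\<close>)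
  then obtain t where t: "0 \<le> t" "t \<le> 1" "less_prob (\<lambda>_. t) N k = less_prob p N k" by blast
  have "t \<noteq> 0" "t \<noteq> 1" using t(3) pos lt1 assms(1,2)
    by (auto simp: less_prob_all_zero less_prob_all_one)
  hence t': "0 < t" "t < 1" using t by auto
  have "s \<le> t"
  proof (rule ccontr)
    assume "\<not> s \<le> t"
    hence "less_prob (\<lambda>_. s) N k \<le> less_prob (\<lambda>_. t) N k"
      unfolding N using t' s assms(1) by (intro less_prob_binomial_antimono) auto
    thus False using False t by simp
  qed
  hence "capped_mean (\<lambda>_. s) N k \<le> capped_mean (\<lambda>_. t) N k"
    unfolding N using t' s by (intro capped_mean_binomial_mono) auto
  also have "\<dots> \<le> capped_mean p N k"
    using capped_mean_ge_binomial[of N p t k] p t' t(3) assms(2) by auto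
  finally have "less_prob (\<lambda>_. s) N k \<le> capped_mean p N k / real k"
    using s(3) assms(1) by (simp add: field_simps)
  thus ?thesis by simp
qed simp

text \<open>The comparison so far concerns probabilities strictly inside the unit interval; the
  closed case follows by moving every \<open>p i\<close> slightly towards \<open>1 / 2\<close> and
  letting the shift tend to 0.\<close>

lemma max_ge_binomial_balance:
  assumes "1 \<le> k" "k \<le> N" and p: "\<And>i. 1 \<le> i \<Longrightarrow> i \<le> N \<Longrightarrow> 0 \<le> p i \<and> p i \<le> 1"
    and s: "0 < s" "s < 1" "capped_mean (\<lambda>_. s) N k = real k * less_prob (\<lambda>_. s) N k"
  shows "less_prob (\<lambda>_. s) N k \<le> max (less_prob p N k) (capped_mean p N k / real k)"
proof -
  define q where "q = (\<lambda>d i. (1 - d) * p i + d / 2 :: real)"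
  let ?f = "\<lambda>d. max (less_prob (q d) N k) (capped_mean (q d) N k / real k)"
  have "continuous_on UNIV ?f"
    unfolding q_def using assms(1)
    by (auto intro!: continuous_intros continuous_less_prob continuous_capped_mean)
  hence "isCont ?f 0" by (simp add: continuous_on_eq_continuous_at)
  hence lim: "(?f \<longlongrightarrow> ?f 0) (at_right 0)"
    unfolding isCont_def by (rule tendsto_within_subset) simp
  have "eventually (\<lambda>d. less_prob (\<lambda>_. s) N k \<le> ?f d) (at_right 0)"
  proof (rule eventually_at_rightI[of 0 1])
    fix d :: real assume d: "d \<in> {0<..<1}"
    show "less_prob (\<lambda>_. s) N k \<le> ?f d"
    proof (rule max_ge_binomial_balance_interior[OF assms(1,2) _ s])
      fix i assume "1 \<le> i" "i \<le> N"
      hence "0 \<le> (1 - d) * p i" "(1 - d) * p i \<le> 1 - d"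
        using d p mult_left_mono[of "p i" 1 "1 - d"] by (auto intro!: mult_nonneg_nonneg)
      moreover have "0 < d / 2" "1 - d + d / 2 < 1" using d by auto
      ultimately have "0 < (1 - d) * p i + d / 2" "(1 - d) * p i + d / 2 < 1" by linarith+
      thus "0 < q d i \<and> q d i < 1" unfolding q_def by blast
    qed
  qed simp
  hence "less_prob (\<lambda>_. s) N k \<le> ?f 0"
    using lim by (intro tendsto_lowerbound[OF lim]) auto
  thus ?thesis by (simp add: q_def)
qed

subsection \<open>Static threshold policies\<close>

text \<open>The closed form of the state equations: \<open>l\<close> units remain before agent
  \<open>i\<close> exactly when \<open>k - l\<close> earlier agents have accepted. As
  \<open>l \<ge> 1\<close>, only counts below \<open>k\<close> occur, where the supply limit has no
  effect yet.\<close>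

definition static_policy :: "nat \<Rightarrow> nat \<Rightarrow> (nat \<Rightarrow> real) \<Rightarrow>
    (nat \<Rightarrow> nat \<Rightarrow> real) \<times> (nat \<Rightarrow> nat \<Rightarrow> real)" where
  "static_policy k n p =
     (\<lambda>i\<in>{1..n}. \<lambda>l\<in>{1..k}. pbin p (i - 1) (k - l),
      \<lambda>i\<in>{1..n}. \<lambda>l\<in>{1..k}. p i * pbin p (i - 1) (k - l))"

definition threshold :: "(nat \<Rightarrow> nat \<Rightarrow> real) \<Rightarrow> nat \<Rightarrow> real \<Rightarrow> nat \<Rightarrow> real" where
  "threshold G J \<rho> i = (1 - \<rho>) * G i (J - 1) + \<rho> * G i J"

lemma type_distributions_mono:
  assumes "(m, G) \<in> type_distributions n" "i \<in> {1..n}" "j \<le> j'" "j' \<le> m"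
  shows "G i j \<le> G i j'"
  using assms(3,4)
proof (induction j' rule: dec_induct)
  case (step l)
  have "G i l \<le> G i (Suc l)" using assms(1,2) step.prems by (auto simp: type_distributions_def)
  thus ?case using step by simp
qed simp

lemma type_distributions_bounds:
  assumes "(m, G) \<in> type_distributions n" "i \<in> {1..n}" "j \<le> m"
  shows "0 \<le> G i j" "G i j \<le> 1"
  using type_distributions_mono[OF assms(1,2), of 0 j] type_distributions_mono[OF assms(1,2), of j m]
    assms by (auto simp: type_distributions_def)

lemma threshold_between:
  assumes "(m, G) \<in> type_distributions n" "i \<in> {1..n}" "J \<in> {1..m}" "0 \<le> \<rho>" "\<rho> \<le> 1"
  shows "G i (J - 1) \<le> threshold G J \<rho> i" "threshold G J \<rho> i \<le> G i J"
proof -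
  have le: "G i (J - 1) \<le> G i J" using assms by (intro type_distributions_mono[OF assms(1,2)]) auto
  have eq: "threshold G J \<rho> i = G i (J - 1) + \<rho> * (G i J - G i (J - 1))"
    "threshold G J \<rho> i = G i J - (1 - \<rho>) * (G i J - G i (J - 1))"
    by (simp_all add: threshold_def algebra_simps)
  show "G i (J - 1) \<le> threshold G J \<rho> i" unfolding eq(1) using le assms by simp
  show "threshold G J \<rho> i \<le> G i J" unfolding eq(2) using le assms by simp
qed

lemma threshold_bounds:
  assumes "(m, G) \<in> type_distributions n" "i \<in> {1..n}" "J \<in> {1..m}" "0 \<le> \<rho>" "\<rho> \<le> 1"
  shows "0 \<le> threshold G J \<rho> i \<and> threshold G J \<rho> i \<le> 1"
proof -
  have "J - 1 \<le> m" "J \<le> m" using assms(3) by auto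
  thus ?thesis
    using threshold_between[OF assms] type_distributions_bounds[OF assms(1,2)] order_trans by blast
qed

lemma static_policy_in_policies:
  assumes "1 \<le> k" "1 \<le> n" and p: "\<And>i. 1 \<le> i \<Longrightarrow> i \<le> n \<Longrightarrow> 0 \<le> p i \<and> p i \<le> 1"
  shows "static_policy k n p \<in> policies k n"
proof -
  have nn: "0 \<le> pbin p (i - 1) l" if "i \<in> {1..n}" for i l
    using that p by (intro pbin_nonneg) auto
  \<comment> \<open>With \<open>j = k - l\<close> the state equation is the recursion of
    \<open>pbin\<close>; for \<open>l = k\<close> it is the case \<open>0\<close>, matching the
    absent inflow.\<close>
  have step: "pbin p (i - 1) (k - l) = pbin p (i - 1 - 1) (k - l)
      - p (i - 1) * pbin p (i - 1 - 1) (k - l)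
      + (if l < k then p (i - 1) * pbin p (i - 1 - 1) (k - (l + 1)) else 0)"
    if "i \<in> {2..n}" "l \<in> {1..k}" for i l
  proof -
    define i' where "i' = i - 2"
    have i': "i = Suc (Suc i')" using that by (auto simp: i'_def)
    show ?thesis
    proof (cases "l < k")
      case True
      hence "k - l = Suc (k - (l + 1))" by simp
      thus ?thesis using True i' by (simp add: algebra_simps)
    qed (use that i' in \<open>auto simp: algebra_simps\<close>)
  qed
  show ?thesis
    unfolding policies_def static_policy_def using assms nn step
    by (auto simp: mult_left_le_one_le)
qed

text \<open>Each row of \<open>x\<close> determines that row of \<open>y\<close> and the next row of
  \<open>x\<close>, so induction on the agent leaves one candidate; extensionality fixes the values
  outside the index ranges.\<close>

lemma threshold_policies_eq:
  assumes "1 \<le> k" "1 \<le> n" "(m, G) \<in> type_distributions n" "J \<in> {1..m}" "0 \<le> \<rho>" "\<rho> \<le> 1"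
  shows "threshold_policies k n G J \<rho> = {static_policy k n (threshold G J \<rho>)}"
proof -
  define p where "p = threshold G J \<rho>"
  have p: "0 \<le> p i \<and> p i \<le> 1" if "1 \<le> i" "i \<le> n" for i
    unfolding p_def using that assms by (intro threshold_bounds[OF assms(3)]) auto
  have "static_policy k n p \<in> threshold_policies k n G J \<rho>"
    using static_policy_in_policies[of k n p] assms(1,2) p
    by (auto simp: threshold_policies_def static_policy_def p_def threshold_def)
  moreover have "(x, y) = static_policy k n p" if xy: "(x, y) \<in> threshold_policies k n G J \<rho>" for x y
  proof -
    have pol: "(x, y) \<in> policies k n" and
      y: "\<And>i l. i \<in> {1..n} \<Longrightarrow> l \<in> {1..k} \<Longrightarrow> y i l = p i * x i l"
      using xy by (auto simp: threshold_policies_def p_def threshold_def)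
    have xy_ext: "x \<in> {1..n} \<rightarrow>\<^sub>E ({1..k} \<rightarrow>\<^sub>E UNIV)" "y \<in> {1..n} \<rightarrow>\<^sub>E ({1..k} \<rightarrow>\<^sub>E UNIV)"
      using pol by (auto simp: policies_def)
    have x: "x (Suc i) l = pbin p i (k - l)" if "Suc i \<le> n" "l \<in> {1..k}" for i l
      using that
    proof (induction i arbitrary: l)
      case 0
      thus ?case using pol by (cases "l = k") (auto simp: policies_def)
    next
      case (Suc i)
      have "x (Suc (Suc i)) l = x (Suc i) l - y (Suc i) l
          + (if l < k then y (Suc i) (l + 1) else 0)"
        using pol Suc.prems unfolding policies_def by force
      also have "\<dots> = (1 - p (Suc i)) * pbin p i (k - l)
          + (if l < k then p (Suc i) * pbin p i (k - (l + 1)) else 0)"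
        using Suc.prems Suc.IH[of l] Suc.IH[of "l + 1"] y[of "Suc i" l] y[of "Suc i" "l + 1"]
        by (auto simp: algebra_simps)
      also have "\<dots> = pbin p (Suc i) (k - l)"
      proof (cases "l < k")
        case True
        hence "k - l = Suc (k - (l + 1))" by simp
        thus ?thesis using True by simp
      qed (use Suc.prems in auto)
      finally show ?case .
    qed
    have x': "x i l = pbin p (i - 1) (k - l)" if "i \<in> {1..n}" "l \<in> {1..k}" for i l
      using x[of "i - 1" l] that by auto
    have "x i = (\<lambda>l\<in>{1..k}. pbin p (i - 1) (k - l))" if "i \<in> {1..n}" for i
      using xy_ext(1) that x' by (auto intro!: ext simp: PiE_iff extensional_def restrict_def)
    hence "x = fst (static_policy k n p)"
      using xy_ext(1) by (auto intro!: ext simp: static_policy_def PiE_iff extensional_def restrict_def)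
    moreover have "y i = (\<lambda>l\<in>{1..k}. p i * pbin p (i - 1) (k - l))" if "i \<in> {1..n}" for i
      using xy_ext(2) that x' y by (auto intro!: ext simp: PiE_iff extensional_def restrict_def)
    hence "y = snd (static_policy k n p)"
      using xy_ext(2) by (auto intro!: ext simp: static_policy_def PiE_iff extensional_def restrict_def)
    ultimately show ?thesis by simp
  qed
  ultimately show ?thesis unfolding p_def[symmetric] by (auto simp del: One_nat_def)
qed

lemma threshold_policy_eq:
  assumes "1 \<le> k" "1 \<le> n" "(m, G) \<in> type_distributions n" "J \<in> {1..m}" "0 \<le> \<rho>" "\<rho> \<le> 1"
  shows "threshold_policy k n G J \<rho> = static_policy k n (threshold G J \<rho>)"
  unfolding threshold_policy_def threshold_policies_eq[OF assms] by simp

text \<open>Both arguments of the minimum carry the factor \<open>x i l\<close>, and summing it over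
  the \<open>k\<close> states with a unit left gives \<open>P(S < k)\<close> for the earlier
  agents.\<close>

lemma accepted_static_policy:
  assumes p: "\<And>i. 1 \<le> i \<Longrightarrow> i \<le> n \<Longrightarrow> 0 \<le> p i \<and> p i \<le> 1"
  shows "accepted k n G j (static_policy k n p)
       = (\<Sum>i<n. min (p (Suc i)) (G (Suc i) j) * less_prob p i k)"
proof -
  have "accepted k n G j (static_policy k n p) =
     (\<Sum>i=1..n. \<Sum>l=1..k. min (p i) (G i j) * pbin p (i - 1) (k - l))"
    unfolding accepted_def static_policy_def
    using p by (auto intro!: sum.cong simp: min_mult_distrib_right pbin_nonneg)
  also have "\<dots> = (\<Sum>i=1..n. min (p i) (G i j) * (\<Sum>l=1..k. pbin p (i - 1) (k - l)))"
    by (simp add: sum_distrib_left)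
  also have "(\<lambda>i. \<Sum>l=1..k. pbin p (i - 1) (k - l)) = (\<lambda>i. less_prob p (i - 1) k)"
    unfolding less_prob_def
    by (intro ext sum.reindex_bij_witness[of _ "\<lambda>j. k - j" "\<lambda>l. k - l"]) auto
  also have "(\<Sum>i=1..n. min (p i) (G i j) * less_prob p (i - 1) k)
     = (\<Sum>i<n. min (p (Suc i)) (G (Suc i) j) * less_prob p i k)"
    by (intro sum.reindex_bij_witness[of _ Suc "\<lambda>i. i - 1"]) auto
  finally show ?thesis by simp
qed

lemma accepted_nonneg:
  assumes p: "\<And>i. 1 \<le> i \<Longrightarrow> i \<le> n \<Longrightarrow> 0 \<le> p i \<and> p i \<le> 1" 
    and "(m, G) \<in> type_distributions n" "j \<le> m"
  shows "0 \<le> accepted k n G j (static_policy k n p)"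
  using type_distributions_bounds(1)[OF assms(2)] assms(3) p
  by (subst accepted_static_policy) (auto intro!: sum_nonneg mult_nonneg_nonneg less_prob_nonneg)

subsection \<open>The benchmarks\<close>

lemma expectation_of_bool_component:
  assumes "finite A" "i \<in> A" "0 \<le> q i" "q i \<le> 1"
  shows "measure_pmf.expectation (Pi_pmf A False (\<lambda>i. bernoulli_pmf (q i))) (\<lambda>b. of_bool (b i)) = q i"
proof -
  have "measure_pmf.expectation (Pi_pmf A False (\<lambda>i. bernoulli_pmf (q i))) (\<lambda>b. of_bool (b i) :: real)
     = measure_pmf.expectation (map_pmf (\<lambda>b. b i) (Pi_pmf A False (\<lambda>i. bernoulli_pmf (q i)))) of_bool"
    by (rule integral_map_pmf[symmetric])
  also have "map_pmf (\<lambda>b. b i) (Pi_pmf A False (\<lambda>i. bernoulli_pmf (q i))) = bernoulli_pmf (q i)"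
    using assms by (simp add: Pi_pmf_component)
  finally show ?thesis using assms by simp
qed

lemma integrable_capped_count:
  "integrable (measure_pmf M) (\<lambda>b. min (\<Sum>i=1..n. of_bool (b i)) (real k))"
  by (rule measure_pmf.integrable_const_bound[of _ "real k"]) (auto simp: sum_nonneg)

text \<open>Jensen's inequality for the concave cap, from bounding the minimum by either
  argument.\<close>

lemma Q_Proph_le_ExAnte:
  assumes "\<And>i. i \<in> {1..n} \<Longrightarrow> 0 \<le> G i j \<and> G i j \<le> 1"
  shows "Q Proph k n G j \<le> Q ExAnte k n G j"
proof -
  let ?M = "Pi_pmf {1..n} False (\<lambda>i. bernoulli_pmf (G i j))"
  have int: "integrable (measure_pmf ?M) (\<lambda>b. of_bool (b i) :: real)" for i
    by (rule measure_pmf.integrable_const_bound[of _ 1]) auto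
  have "Q Proph k n G j \<le> measure_pmf.expectation ?M (\<lambda>b. \<Sum>i=1..n. of_bool (b i))"
    unfolding Q.simps by (intro integral_mono integrable_capped_count Bochner_Integration.integrable_sum int) simp
  also have "\<dots> = (\<Sum>i=1..n. G i j)"
    using assms by (subst Bochner_Integration.integral_sum[OF int])
      (auto intro!: sum.cong expectation_of_bool_component)
  finally have "Q Proph k n G j \<le> (\<Sum>i=1..n. G i j)" .
  moreover have "Q Proph k n G j \<le> measure_pmf.expectation ?M (\<lambda>b. real k)"
    unfolding Q.simps by (intro integral_mono integrable_capped_count) simp_all
  ultimately show ?thesis by simp
qed

lemma Q_nonneg:
  assumes "\<And>i. i \<in> {1..n} \<Longrightarrow> 0 \<le> G i j"
  shows "0 \<le> Q b k n G j"
  using assms by (cases b) (auto intro!: integral_nonneg sum_nonneg)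

text \<open>Bounds the benchmark of the rare type in the hard instance from below: as
  \<open>k \<ge> 1\<close>, the capped count dominates every single indicator.\<close>

lemma Q_Proph_ge_component:
  assumes "1 \<le> k" "i \<in> {1..n}" "0 \<le> G i j" "G i j \<le> 1"
  shows "G i j \<le> Q Proph k n G j"
proof -
  let ?M = "Pi_pmf {1..n} False (\<lambda>i. bernoulli_pmf (G i j))"
  have "G i j = measure_pmf.expectation ?M (\<lambda>b. of_bool (b i))"
    using assms by (subst expectation_of_bool_component) auto
  also have "\<dots> \<le> Q Proph k n G j"
    unfolding Q.simps
  proof (intro integral_mono integrable_capped_count)
    show "integrable (measure_pmf ?M) (\<lambda>b. of_bool (b i) :: real)"
      by (rule measure_pmf.integrable_const_bound[of _ 1]) auto
    fix b :: "nat \<Rightarrow> bool"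
    have "of_bool (b i) \<le> (\<Sum>i=1..n. of_bool (b i) :: real)"
      using assms by (intro member_le_sum) auto
    thus "of_bool (b i) \<le> min (\<Sum>i=1..n. of_bool (b i)) (real k)" using assms by auto
  qed
  finally show ?thesis .
qed

lemma Q_Proph_all_one:
  assumes "k \<le> n" "\<And>i. i \<in> {1..n} \<Longrightarrow> G i j = 1"
  shows "Q Proph k n G j = real k"
proof -
  let ?M = "Pi_pmf {1..n} False (\<lambda>i. bernoulli_pmf (G i j))"
  have "Q Proph k n G j = measure_pmf.expectation ?M (\<lambda>b. real k)"
    unfolding Q.simps
  proof (intro integral_cong_AE)
    show "AE b in measure_pmf ?M. min (\<Sum>i=1..n. of_bool (b i)) (real k) = real k"
      unfolding AE_measure_pmf_iff
    proof
      fix b assume "b \<in> set_pmf ?M"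
      hence "b i" if "i \<in> {1..n}" for i
        using that assms(2)[OF that] by (cases "b i") (auto simp: set_Pi_pmf PiE_dflt_def set_pmf_iff)
      thus "min (\<Sum>i=1..n. of_bool (b i)) (real k) = real k" using assms(1) by simp
    qed
  qed simp_all
  thus ?thesis by simp
qed

subsection \<open>Comparison of the linear programs\<close>

lemma innerLP_OST_ExAnte_le_Proph:
  assumes "1 \<le> k" "1 \<le> n" "(m, G) \<in> type_distributions n" "J \<in> {1..m}" "0 \<le> \<rho>" "\<rho> \<le> 1"
  shows "innerLP_OST ExAnte k n m G J \<rho> \<le> innerLP_OST Proph k n m G J \<rho>"
proof -
  let ?p = "static_policy k n (threshold G J \<rho>)"
  have tp: "\<And>i. 1 \<le> i \<Longrightarrow> i \<le> n \<Longrightarrow> 0 \<le> threshold G J \<rho> i \<and> threshold G J \<rho> i \<le> 1"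
    using threshold_bounds[OF assms(3) _ assms(4-6)] by simp
  show ?thesis
    unfolding innerLP_OST_def threshold_policies_eq[OF assms]
  proof (rule complete_lattice_class.Sup_mono)
    fix v assume "v \<in> {ereal \<theta> |\<theta>. \<exists>p\<in>{?p}. \<forall>j\<in>{1..m}. \<theta> * Q ExAnte k n G j \<le> accepted k n G j p}"
    then obtain \<theta> where v: "v = ereal \<theta>"
      and feas: "\<forall>j\<in>{1..m}. \<theta> * Q ExAnte k n G j \<le> accepted k n G j ?p" by auto
    \<comment> \<open>A negative \<open>\<theta>\<close> reverses the comparison of the benchmarks,
      so it is replaced by 0, which is feasible because \<open>accepted\<close> is
      nonnegative.\<close>
    have "max \<theta> 0 * Q Proph k n G j \<le> accepted k n G j ?p" if j: "j \<in> {1..m}" for j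
    proof (cases "0 \<le> \<theta>")
      case True
      have "\<theta> * Q Proph k n G j \<le> \<theta> * Q ExAnte k n G j"
        using True j type_distributions_bounds[OF assms(3)]
        by (intro mult_left_mono Q_Proph_le_ExAnte) auto
      thus ?thesis using feas j True by fastforce
    next
      case False
      thus ?thesis using accepted_nonneg[of n "threshold G J \<rho>" m G j k] tp assms(3) j by auto
    qed
    moreover have "ereal \<theta> \<le> ereal (max \<theta> 0)" by simp
    ultimately show "\<exists>b\<in>{ereal \<theta> |\<theta>. \<exists>p\<in>{?p}. \<forall>j\<in>{1..m}. \<theta> * Q Proph k n G j \<le> accepted k n G j p}. v \<le> b"
      unfolding v
      by blast
  qed
qed

lemma innerLP_ST_ExAnte_le_Proph:
  assumes "1 \<le> k" "1 \<le> n" "(m, G) \<in> type_distributions n"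
  shows "innerLP_ST ExAnte k n m G \<le> innerLP_ST Proph k n m G"
  unfolding innerLP_ST_def
proof (rule complete_lattice_class.Sup_mono, clarify)
  fix \<theta> \<mu>
  assume \<mu>: "\<mu> \<in> threshold_distributions m"
    and feas: "\<forall>j\<in>{1..m}. \<theta> * Q ExAnte k n G j
      \<le> (LINT (J, \<rho>)|\<mu>. accepted k n G j (threshold_policy k n G J \<rho>))"
  have sp: "space \<mu> = {1..m} \<times> {0<..1}"
    using \<mu> sets_eq_imp_space_eq[of \<mu> "count_space {1..m} \<Otimes>\<^sub>M restrict_space borel {0<..1}"]
    by (simp add: threshold_distributions_def space_pair_measure space_restrict_space)
  have "max \<theta> 0 * Q Proph k n G j
      \<le> (LINT (J, \<rho>)|\<mu>. accepted k n G j (threshold_policy k n G J \<rho>))"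
    if j: "j \<in> {1..m}" for j
  proof (cases "0 \<le> \<theta>")
    case True
    have "\<theta> * Q Proph k n G j \<le> \<theta> * Q ExAnte k n G j"
      using True j type_distributions_bounds[OF assms(3)]
      by (intro mult_left_mono Q_Proph_le_ExAnte) auto
    thus ?thesis using feas j True by fastforce
  next
    case False
    have "0 \<le> (LINT (J, \<rho>)|\<mu>. accepted k n G j (threshold_policy k n G J \<rho>))"
    proof (rule Bochner_Integration.integral_nonneg, clarsimp simp: sp)
      fix J \<rho> assume J: "Suc 0 \<le> J" "J \<le> m" and \<rho>: "0 < \<rho>" "\<rho> \<le> (1::real)"
      have "0 \<le> accepted k n G j (static_policy k n (threshold G J \<rho>))"
        by (rule accepted_nonneg[OF _ assms(3)])
          (use J \<rho> j threshold_bounds[OF assms(3), of _ J \<rho>] in auto)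
      thus "0 \<le> accepted k n G j (threshold_policy k n G J \<rho>)"
        using J \<rho> by (subst threshold_policy_eq[OF assms]) auto
    qed
    thus ?thesis using False by simp
  qed
  moreover have "ereal \<theta> \<le> ereal (max \<theta> 0)" by simp
  ultimately show "\<exists>b\<in>{ereal \<theta> |\<theta>. \<exists>\<mu>\<in>threshold_distributions m. \<forall>j\<in>{1..m}. \<theta> * Q Proph k n G j
      \<le> (LINT (J, \<rho>)|\<mu>. accepted k n G j (threshold_policy k n G J \<rho>))}. ereal \<theta> \<le> b"
    using \<mu> by blast
qed

text \<open>Needed to integrate against a point mass. The first factor is countable, and for fixed
  \<open>J\<close> the closed form is continuous in \<open>\<rho>\<close>.\<close>

lemma measurable_accepted_threshold:
  assumes "1 \<le> k" "1 \<le> n" "(m, G) \<in> type_distributions n"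
  shows "(\<lambda>(J, \<rho>). accepted k n G j (threshold_policy k n G J \<rho>))
     \<in> borel_measurable (count_space {1..m} \<Otimes>\<^sub>M restrict_space borel {0<..1})"
proof (rule measurable_pair_measure_countable1)
  fix J assume J: "J \<in> {1..m}"
  have "continuous_on {0<..1} (\<lambda>\<rho>. \<Sum>i<n. min (threshold G J \<rho> (Suc i)) (G (Suc i) j)
      * less_prob (threshold G J \<rho>) i k)"
    unfolding threshold_def by (intro continuous_intros continuous_less_prob)
  hence "(\<lambda>\<rho>. \<Sum>i<n. min (threshold G J \<rho> (Suc i)) (G (Suc i) j)
      * less_prob (threshold G J \<rho>) i k) \<in> borel_measurable (restrict_space borel {0<..1})"
    by (rule borel_measurable_continuous_on_restrict)
  also have "?this \<longleftrightarrow> (\<lambda>\<rho>. accepted k n G j (threshold_policy k n G J \<rho>))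
      \<in> borel_measurable (restrict_space borel {0<..1})"
  proof (rule measurable_cong)
    fix \<rho> :: real assume "\<rho> \<in> space (restrict_space borel {0<..1})"
    hence \<rho>: "0 \<le> \<rho>" "\<rho> \<le> 1" by (auto simp: space_restrict_space)
    show "(\<Sum>i<n. min (threshold G J \<rho> (Suc i)) (G (Suc i) j) * less_prob (threshold G J \<rho>) i k)
        = accepted k n G j (threshold_policy k n G J \<rho>)"
      unfolding threshold_policy_eq[OF assms J \<rho>]
      using threshold_bounds[OF assms(3) _ J \<rho>] by (intro accepted_static_policy[symmetric]) auto
  qed
  finally show "(\<lambda>\<rho>. case (J, \<rho>) of (J, \<rho>) \<Rightarrow> accepted k n G j (threshold_policy k n G J \<rho>))
      \<in> borel_measurable (restrict_space borel {0<..1})" by simp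
qed simp

text \<open>A fixed threshold is the random threshold whose law is the point mass at
  \<open>(J, \<rho>)\<close>.\<close>

lemma innerLP_OST_le_ST:
  assumes "1 \<le> k" "1 \<le> n" "(m, G) \<in> type_distributions n" "J \<in> {1..m}" "0 < \<rho>" "\<rho> \<le> 1"
  shows "innerLP_OST b k n m G J \<rho> \<le> innerLP_ST b k n m G"
  unfolding innerLP_OST_def innerLP_ST_def
proof (intro Sup_subset_mono subsetI, clarify)
  fix \<theta> x y
  assume p: "(x, y) \<in> threshold_policies k n G J \<rho>"
    and feas: "\<forall>j\<in>{1..m}. \<theta> * Q b k n G j \<le> accepted k n G j (x, y)"
  have xy: "(x, y) = threshold_policy k n G J \<rho>"
    using p assms threshold_policies_eq[OF assms(1-4)] threshold_policy_eq[OF assms(1-4)] by auto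
  let ?M = "count_space {1..m} \<Otimes>\<^sub>M restrict_space borel {0<..1}"
  have in_space: "(J, \<rho>) \<in> space ?M"
    using assms by (simp add: space_pair_measure space_restrict_space)
  have "(LINT (J, \<rho>)|return ?M (J, \<rho>). accepted k n G j (threshold_policy k n G J \<rho>))
      = accepted k n G j (x, y)" for j
    by (subst integral_return[OF in_space measurable_accepted_threshold[OF assms(1-3)]])
      (simp add: xy)
  moreover have "return ?M (J, \<rho>) \<in> threshold_distributions m"
    using in_space
    by (simp add: threshold_distributions_def prob_space_return del: One_nat_def)
  ultimately show "\<exists>\<theta>'. ereal \<theta> = ereal \<theta>' \<and> (\<exists>\<mu>\<in>threshold_distributions m. \<forall>j\<in>{1..m}.
      \<theta>' * Q b k n G j \<le> (LINT (J, \<rho>)|\<mu>. accepted k n G j (threshold_policy k n G J \<rho>)))"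
    using feas by (intro exI[of _ \<theta>] conjI refl bexI[of _ "return ?M (J, \<rho>)"]) auto
qed

subsection \<open>The common value\<close>

text \<open>The thresholds form a path from rejecting everyone to accepting everyone, along which
  the continuous difference \<open>h\<close> changes sign.\<close>

lemma balanced_threshold_exists:
  assumes "1 \<le> k" "k \<le> N" and G: "(m, G) \<in> type_distributions (Suc N)"
  obtains J \<rho> where "J \<in> {1..m}" "0 < \<rho>" "\<rho> \<le> 1"
    "capped_mean (threshold G J \<rho>) (Suc N) k = real k * less_prob (threshold G J \<rho>) N k"
proof -
  define h where "h = (\<lambda>p. capped_mean p (Suc N) k - real k * less_prob p N k)"
  have h_cong: "h p = h q" if "\<And>i. i \<in> {1..Suc N} \<Longrightarrow> p i = q i" for p q
    unfolding h_def using capped_mean_cong[of "Suc N" p q k] less_prob_cong[of N p q k] that by simp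
  \<comment> \<open>The first type with nonnegative \<open>h\<close> puts the sign change on the
    segment from \<open>J - 1\<close> to \<open>J\<close>; strictness at \<open>J - 1\<close> later
    excludes \<open>\<rho> = 0\<close>.\<close>
  define J where "J = (LEAST j. 0 \<le> h (\<lambda>i. G i j))"
  have h0: "h (\<lambda>i. G i 0) < 0"
  proof -
    have "h (\<lambda>i. G i 0) = h (\<lambda>_. 0)"
      using G by (intro h_cong) (auto simp: type_distributions_def)
    thus ?thesis using assms(1) by (simp add: h_def capped_mean_all_zero less_prob_all_zero)
  qed
  have hm: "0 \<le> h (\<lambda>i. G i m)"
  proof -
    have "h (\<lambda>i. G i m) = h (\<lambda>_. 1)"
      using G by (intro h_cong) (auto simp: type_distributions_def)
    thus ?thesis using assms(2) by (simp add: h_def capped_mean_all_one less_prob_all_one)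
  qed
  have hJ: "0 \<le> h (\<lambda>i. G i J)" unfolding J_def by (rule LeastI[of _ m]) (rule hm)
  have "J \<le> m" unfolding J_def by (rule Least_le) (rule hm)
  have "J \<noteq> 0" using hJ h0 by (auto intro: ccontr)
  hence hJ': "h (\<lambda>i. G i (J - 1)) < 0"
    using not_less_Least[of "J - 1" "\<lambda>j. 0 \<le> h (\<lambda>i. G i j)"] unfolding J_def by simp
  have cont: "continuous_on {0..1} (\<lambda>\<rho>. h (threshold G J \<rho>))"
    unfolding h_def threshold_def
    by (intro continuous_intros continuous_less_prob continuous_capped_mean)
  have ends: "threshold G J 0 = (\<lambda>i. G i (J - 1))" "threshold G J 1 = (\<lambda>i. G i J)"
    by (auto simp: threshold_def)
  have "\<exists>\<rho>\<ge>0. \<rho> \<le> 1 \<and> h (threshold G J \<rho>) = 0"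
    by (rule IVT'[OF _ _ _ cont]) (use hJ hJ' ends in auto)
  then obtain \<rho> where \<rho>: "0 \<le> \<rho>" "\<rho> \<le> 1" "h (threshold G J \<rho>) = 0" by blast
  moreover have "\<rho> \<noteq> 0" using \<rho>(3) hJ' ends(1) by auto
  ultimately show ?thesis using \<open>J \<noteq> 0\<close> \<open>J \<le> m\<close> by (intro that[of J \<rho>]) (auto simp: h_def)
qed

text \<open>At the balanced threshold let \<open>r = less_prob p N k\<close>. For
  \<open>j \<ge> J\<close> all sales count and amount to \<open>k * r\<close>; for
  \<open>j < J\<close> all of \<open>G i j\<close> is accepted whenever a unit is left, which has
  probability at least \<open>r\<close>.\<close>

lemma innerLP_OST_ExAnte_ge:
  assumes k: "1 \<le> k" "k \<le> N" and G: "(m, G) \<in> type_distributions (Suc N)"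
    and s: "0 < s" "s < 1" "capped_mean (\<lambda>_. s) N k = real k * less_prob (\<lambda>_. s) N k"
  shows "\<exists>J\<in>{1..m}. \<exists>\<rho>\<in>{0<..1}.
    ereal (less_prob (\<lambda>_. s) N k) \<le> innerLP_OST ExAnte k (Suc N) m G J \<rho>"
proof -
  define v where "v = less_prob (\<lambda>_. s) N k"
  obtain J \<rho> where J: "J \<in> {1..m}" and \<rho>: "0 < \<rho>" "\<rho> \<le> 1"
    and bal: "capped_mean (threshold G J \<rho>) (Suc N) k = real k * less_prob (threshold G J \<rho>) N k"
    by (rule balanced_threshold_exists[OF k G])
  define p where "p = threshold G J \<rho>"
  have p: "0 \<le> p i \<and> p i \<le> 1" if "1 \<le> i" "i \<le> Suc N" for i
    unfolding p_def using that J \<rho> by (intro threshold_bounds[OF G]) auto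
  have v0: "0 \<le> v" unfolding v_def using s by (intro less_prob_nonneg) auto
  \<comment> \<open>Dropping the last agent from the balance equation shows that
    \<open>less_prob\<close> is the larger term of the maximum used below.\<close>
  have "0 \<le> p (Suc N) * less_prob p N k"
    using p by (intro mult_nonneg_nonneg less_prob_nonneg) auto
  hence "capped_mean p N k \<le> real k * less_prob p N k"
    using bal by (simp add: capped_mean_Suc p_def)
  hence "capped_mean p N k / real k \<le> less_prob p N k" using k by (simp add: field_simps)
  moreover have "v \<le> max (less_prob p N k) (capped_mean p N k / real k)"
    unfolding v_def using p by (intro max_ge_binomial_balance[OF k _ s]) auto
  ultimately have v: "v \<le> less_prob p N k" by simp
  have feas: "v * Q ExAnte k (Suc N) G j \<le> accepted k (Suc N) G j (static_policy k (Suc N) p)"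
    if j: "j \<in> {1..m}" for j
  proof -
    have acc: "accepted k (Suc N) G j (static_policy k (Suc N) p)
        = (\<Sum>i<Suc N. min (p (Suc i)) (G (Suc i) j) * less_prob p i k)"
      by (rule accepted_static_policy[OF p])
    show ?thesis
    proof (cases "J \<le> j")
      case True
      have "p (Suc i) \<le> G (Suc i) j" if "i < Suc N" for i
        unfolding p_def using that J \<rho> j True
          threshold_between(2)[OF G, of "Suc i" J \<rho>] type_distributions_mono[OF G, of "Suc i" J j]
        by auto
      hence "accepted k (Suc N) G j (static_policy k (Suc N) p) = capped_mean p (Suc N) k"
        unfolding acc capped_mean_def by (intro sum.cong) (auto simp: min_absorb1)
      also have "\<dots> = less_prob p N k * real k" using bal by (simp add: p_def)
      also have "\<dots> \<ge> v * Q ExAnte k (Suc N) G j"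
        using v v0 k type_distributions_bounds(1)[OF G] j
        by (intro mult_mono Q_nonneg) auto
      finally show ?thesis .
    next
      case False
      have le: "G (Suc i) j \<le> p (Suc i)" if "i < Suc N" for i
      proof -
        have "j \<le> J - 1" "J - 1 \<le> m" "Suc i \<in> {1..Suc N}" using J False that by auto
        thus ?thesis unfolding p_def
          using J \<rho> threshold_between(1)[OF G, of "Suc i" J \<rho>]
            type_distributions_mono[OF G, of "Suc i" j "J - 1"]
          by (meson less_imp_le order_trans)
      qed
      have "v * Q ExAnte k (Suc N) G j \<le> v * (\<Sum>i=1..Suc N. G i j)"
        using v0 by (intro mult_left_mono) auto
      also have "(\<Sum>i=1..Suc N. G i j) = (\<Sum>i<Suc N. G (Suc i) j)"
        by (intro sum.reindex_bij_witness[of _ Suc "\<lambda>i. i - 1"]) auto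
      also have "v * \<dots> = (\<Sum>i<Suc N. G (Suc i) j * v)"
        by (simp only: sum_distrib_left mult.commute)
      also have "\<dots> \<le> (\<Sum>i<Suc N. G (Suc i) j * less_prob p i k)"
      proof (intro sum_mono mult_left_mono)
        fix i assume i: "i \<in> {..<Suc N}"
        have "less_prob p N k \<le> less_prob p i k" using p i by (intro less_prob_antimono) auto
        thus "v \<le> less_prob p i k" using v by simp
        show "0 \<le> G (Suc i) j" using type_distributions_bounds(1)[OF G, of "Suc i" j] i j by auto
      qed
      also have "\<dots> = accepted k (Suc N) G j (static_policy k (Suc N) p)"
        unfolding acc using le by (intro sum.cong) (auto simp: min_absorb2)
      finally show ?thesis .
    qed
  qed
  have tp: "threshold_policies k (Suc N) G J \<rho> = {static_policy k (Suc N) p}"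
    unfolding p_def using k J \<rho> by (intro threshold_policies_eq[OF _ _ G]) auto
  have "ereal v \<le> innerLP_OST ExAnte k (Suc N) m G J \<rho>"
    unfolding innerLP_OST_def tp by (rule Sup_upper) (use feas in blast)
  thus ?thesis
    using J \<rho> unfolding v_def by (intro bexI[of _ J] bexI[of _ \<rho>]) auto
qed

text \<open>
  The last agent has the top type with the small probability \<open>\<epsilon>\<close>, so the constraint \<open>j = 1\<close> bounds
  \<open>\<theta>\<close> by the probability that a unit is left for that agent, while \<open>j = 3\<close> bounds \<open>\<theta>\<close> by the
  fraction of units sold. For \<open>i < n\<close> every threshold accepts all agents with one common probability.
\<close>

definition hard_instance :: "nat \<Rightarrow> real \<Rightarrow> nat \<Rightarrow> nat \<Rightarrow> real" where
  "hard_instance n \<epsilon> i j =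
     (if j = 0 then 0
      else if i = n then (if j \<le> 2 then \<epsilon> else 1)
      else (if j \<ge> 2 then 1 else 0))"

lemma hard_instance_type_distribution:
  assumes "0 \<le> \<epsilon>" "\<epsilon> \<le> 1"
  shows "(3, hard_instance n \<epsilon>) \<in> type_distributions n"
  using assms by (auto simp: type_distributions_def hard_instance_def)

text \<open>The tangent weights combine the constraints \<open>j = 1\<close> and
  \<open>j = 3\<close> into one bound that every single threshold satisfies up to
  \<open>\<epsilon>\<close>, hence every mixture does.\<close>

lemma innerLP_ST_hard_instance_le:
  assumes k: "1 \<le> k" "k \<le> N" and \<epsilon>: "0 < \<epsilon>" "\<epsilon> < 1"
    and s: "0 < s" "s < 1" "capped_mean (\<lambda>_. s) N k = real k * less_prob (\<lambda>_. s) N k"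
  shows "innerLP_ST Proph k (Suc N) 3 (hard_instance (Suc N) \<epsilon>) \<le> ereal (less_prob (\<lambda>_. s) N k + \<epsilon>)"
proof -
  define v where "v = less_prob (\<lambda>_. s) N k"
  define G where "G = hard_instance (Suc N) \<epsilon>"
  note G_def' = G_def[THEN fun_cong, THEN fun_cong, unfolded hard_instance_def]
  have G: "(3, G) \<in> type_distributions (Suc N)"
    unfolding G_def using \<epsilon> by (intro hard_instance_type_distribution) auto
  obtain M where M: "N = Suc M" using k by (cases N) auto
  obtain a where a: "0 \<le> a" "a \<le> 1" and mix: "\<And>t. 0 \<le> t \<Longrightarrow> t \<le> 1 \<Longrightarrow>
      a * less_prob (\<lambda>_. t) N k + (1 - a) * capped_mean (\<lambda>_. t) N k / real k
      \<le> a * less_prob (\<lambda>_. s) N k + (1 - a) * capped_mean (\<lambda>_. s) N k / real k"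
    using binomial_mixture_max[of k M s] k s M by blast
  have mix: "a * less_prob (\<lambda>_. t) N k + (1 - a) * (capped_mean (\<lambda>_. t) N k / real k) \<le> v"
    if "0 \<le> t" "t \<le> 1" for t
  proof -
    have "(1 - a) * capped_mean (\<lambda>_. s) N k / real k = (1 - a) * v"
      using s(3) k by (simp add: v_def)
    moreover have "a * v + (1 - a) * v = v" by (simp add: algebra_simps)
    ultimately show ?thesis using mix[OF that] by (simp add: v_def)
  qed
  have v0: "0 \<le> v" unfolding v_def using s by (intro less_prob_nonneg) auto
  define A where "A = (\<lambda>j J \<rho>. accepted k (Suc N) G j (threshold_policy k (Suc N) G J \<rho>))"
  have A: "a / \<epsilon> * A 1 J \<rho> + (1 - a) / real k * A 3 J \<rho> \<le> v + \<epsilon>"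
    if J: "J \<in> {1..3}" and \<rho>: "0 < \<rho>" "\<rho> \<le> 1" for J \<rho>
  proof -
    define p where "p = threshold G J \<rho>"
    have p: "0 \<le> p i \<and> p i \<le> 1" if "1 \<le> i" "i \<le> Suc N" for i
      unfolding p_def using that J \<rho> by (intro threshold_bounds[OF G]) auto
    \<comment> \<open>\<open>t\<close> is the common acceptance probability of the first
      \<open>N\<close> agents: all their mass sits at type 2, so only \<open>J = 2\<close>
      interpolates.\<close>
    define t where "t = (if J = 1 then 0 else if J = 2 then \<rho> else 1)"
    have t: "0 \<le> t" "t \<le> 1" using \<rho> by (auto simp: t_def)
    have pt: "p i = t" if "i \<in> {1..N}" for i
      using that J by (auto simp: p_def threshold_def G_def' t_def)
    have g: "less_prob p N k = less_prob (\<lambda>_. t) N k"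
      using pt by (intro less_prob_cong) auto
    have g01: "0 \<le> less_prob (\<lambda>_. t) N k" "less_prob (\<lambda>_. t) N k \<le> 1"
      using t by (auto intro!: less_prob_nonneg less_prob_le_1)
    \<comment> \<open>Either the last agent accepts with probability at most
      \<open>\<epsilon>\<close>, or \<open>J = 3\<close> and the first \<open>N \<ge> k\<close>
      agents have taken every unit.\<close>
    have last: "p (Suc N) * less_prob (\<lambda>_. t) N k \<le> \<epsilon>"
    proof (cases "J = 3")
      case True
      thus ?thesis using k \<epsilon> by (simp add: t_def less_prob_all_one)
    next
      case False
      hence "p (Suc N) \<le> \<epsilon>"
        using J \<rho> \<epsilon> by (auto simp: p_def threshold_def G_def' algebra_simps)
      hence "p (Suc N) * less_prob (\<lambda>_. t) N k \<le> \<epsilon> * 1"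
        using g01 \<epsilon> by (intro mult_mono) auto
      thus ?thesis by simp
    qed
    have AJ: "A j J \<rho> = (\<Sum>i<Suc N. min (p (Suc i)) (G (Suc i) j) * less_prob p i k)" for j
      unfolding A_def p_def using k J \<rho> p[unfolded p_def]
      by (subst threshold_policy_eq[OF _ _ G]) (auto simp: accepted_static_policy)
    have "A 1 J \<rho> = min (p (Suc N)) \<epsilon> * less_prob p N k"
      unfolding AJ using p by (simp add: G_def')
    also have "\<dots> \<le> \<epsilon> * less_prob (\<lambda>_. t) N k"
      unfolding g using g01 by (intro mult_right_mono) auto
    finally have A1: "A 1 J \<rho> \<le> \<epsilon> * less_prob (\<lambda>_. t) N k" .
    have "A 3 J \<rho> = capped_mean p (Suc N) k"
      unfolding AJ capped_mean_def using p by (intro sum.cong) (auto simp: G_def')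
    also have "\<dots> \<le> capped_mean (\<lambda>_. t) N k + \<epsilon>"
      using capped_mean_cong[of N p "\<lambda>_. t" k] pt last by (simp add: capped_mean_Suc g)
    finally have A3: "A 3 J \<rho> \<le> capped_mean (\<lambda>_. t) N k + \<epsilon>" .
    have "a / \<epsilon> * A 1 J \<rho> \<le> a / \<epsilon> * (\<epsilon> * less_prob (\<lambda>_. t) N k)"
      using A1 a \<epsilon> by (intro mult_left_mono) auto
    moreover have "(1 - a) / real k * A 3 J \<rho> \<le> (1 - a) / real k * (capped_mean (\<lambda>_. t) N k + \<epsilon>)"
      using A3 a by (intro mult_left_mono) auto
    moreover have "(1 - a) / real k * \<epsilon> \<le> 1 * \<epsilon>"
      using a k \<epsilon> by (intro mult_right_mono) (auto simp: divide_le_eq)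
    ultimately show ?thesis using mix[OF t] \<epsilon> by (simp add: algebra_simps)
  qed
  have "\<theta> \<le> v + \<epsilon>" if \<mu>: "\<mu> \<in> threshold_distributions 3"
    and feas: "\<forall>j\<in>{1..3}. \<theta> * Q Proph k (Suc N) G j \<le> (LINT (J, \<rho>)|\<mu>. A j J \<rho>)" for \<theta> \<mu>
  proof (cases "\<theta> \<le> 0")
    case False
    interpret prob_space \<mu> using \<mu> by (simp add: threshold_distributions_def)
    have sp: "space \<mu> = {1..3} \<times> {0<..1}"
      using \<mu> sets_eq_imp_space_eq[of \<mu> "count_space {1..3} \<Otimes>\<^sub>M restrict_space borel {0<..1}"]
      by (simp add: threshold_distributions_def space_pair_measure space_restrict_space)
    have "\<epsilon> \<le> Q Proph k (Suc N) G 1"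
      using Q_Proph_ge_component[of k "Suc N" "Suc N" G 1] k \<epsilon> by (simp add: G_def' del: Q.simps)
    hence "\<theta> * \<epsilon> \<le> \<theta> * Q Proph k (Suc N) G 1" using False by (intro mult_left_mono) auto
    also have "\<dots> \<le> (LINT (J, \<rho>)|\<mu>. A 1 J \<rho>)" using feas by (simp del: Q.simps)
    finally have 1: "\<theta> * \<epsilon> \<le> (LINT (J, \<rho>)|\<mu>. A 1 J \<rho>)" .
    have "Q Proph k (Suc N) G 3 = real k"
      using k by (intro Q_Proph_all_one) (auto simp: G_def')
    hence 3: "\<theta> * real k \<le> (LINT (J, \<rho>)|\<mu>. A 3 J \<rho>)" using bspec[OF feas, of 3] by simp
    have pos: "0 < \<theta> * \<epsilon>" "0 < \<theta> * real k" using False \<epsilon> k by auto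
    \<comment> \<open>Nonintegrable functions have integral 0, so the positive lower bounds force
      integrability.\<close>
    have int: "integrable \<mu> (\<lambda>(J, \<rho>). A 1 J \<rho>)" "integrable \<mu> (\<lambda>(J, \<rho>). A 3 J \<rho>)"
      using 1 3 pos not_integrable_integral_eq by force+
    have "\<theta> = a / \<epsilon> * (\<theta> * \<epsilon>) + (1 - a) / real k * (\<theta> * real k)"
      using \<epsilon> k by (simp add: field_simps)
    also have "\<dots> \<le> a / \<epsilon> * (LINT (J, \<rho>)|\<mu>. A 1 J \<rho>) + (1 - a) / real k * (LINT (J, \<rho>)|\<mu>. A 3 J \<rho>)"
      using 1 3 a \<epsilon> by (intro add_mono mult_left_mono) auto
    also have "\<dots> = (LINT z|\<mu>. a / \<epsilon> * (case z of (J, \<rho>) \<Rightarrow> A 1 J \<rho>)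
        + (1 - a) / real k * (case z of (J, \<rho>) \<Rightarrow> A 3 J \<rho>))"
      using int by (subst Bochner_Integration.integral_add) auto
    also have "\<dots> \<le> (LINT z|\<mu>. v + \<epsilon>)"
      using int A sp
      by (intro integral_mono Bochner_Integration.integrable_add integrable_mult_right) auto
    also have "\<dots> = v + \<epsilon>" by (simp add: prob_space)
    finally show ?thesis .
  qed (use v0 \<epsilon> in auto)
  thus ?thesis
    unfolding innerLP_ST_def v_def[symmetric] G_def[symmetric] A_def by (intro Sup_least) auto
qed

section \<open>Collapse of the four infima to the balanced value\<close>

theorem theorem6:
  fixes k n :: nat
  assumes "k \<ge> 1" and "n > k"
  shows "(INF (m, G)\<in>type_distributions n. innerLP_ST Proph k n m G)
       = (INF (m, G)\<in>type_distributions n. innerLP_ST ExAnte k n m G)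
     \<and> (INF (m, G)\<in>type_distributions n. innerLP_ST ExAnte k n m G)
       = (INF (m, G)\<in>type_distributions n.
            SUP (J, \<rho>)\<in>{1..m} \<times> {0<..1}. innerLP_OST Proph k n m G J \<rho>)
     \<and> (INF (m, G)\<in>type_distributions n.
            SUP (J, \<rho>)\<in>{1..m} \<times> {0<..1}. innerLP_OST Proph k n m G J \<rho>)
       = (INF (m, G)\<in>type_distributions n.
            SUP (J, \<rho>)\<in>{1..m} \<times> {0<..1}. innerLP_OST ExAnte k n m G J \<rho>)"
proof -
  let ?ST = "\<lambda>b. INF (m, G)\<in>type_distributions n. innerLP_ST b k n m G"
  let ?OST = "\<lambda>b. INF (m, G)\<in>type_distributions n.
            SUP (J, \<rho>)\<in>{1..m} \<times> {0<..1}. innerLP_OST b k n m G J \<rho>"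
  obtain N where n: "n = Suc N" and k: "1 \<le> k" "k \<le> N" using assms by (cases n) auto
  have n1: "1 \<le> n" using n by simp
  obtain s where s: "0 < s" "s < 1" "capped_mean (\<lambda>_. s) N k = real k * less_prob (\<lambda>_. s) N k"
    by (rule binomial_balance_point[OF k])
  define v where "v = less_prob (\<lambda>_. s) N k"
  have ST: "?ST ExAnte \<le> ?ST Proph"
    by (intro INF_superset_mono subset_refl) (auto intro!: innerLP_ST_ExAnte_le_Proph k n1)
  have OST: "?OST ExAnte \<le> ?OST Proph"
    by (intro INF_superset_mono subset_refl)
      (auto intro!: SUP_subset_mono innerLP_OST_ExAnte_le_Proph k n1)
  have OST_ST: "?OST b \<le> ?ST b" for b
    by (intro INF_superset_mono subset_refl) (auto intro!: SUP_least innerLP_OST_le_ST k n1)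
  have "ereal v \<le> ?OST ExAnte"
  proof (rule INF_greatest, clarify)
    fix m G assume "(m, G) \<in> type_distributions n"
    then obtain J \<rho> where "J \<in> {1..m}" "\<rho> \<in> {0<..1}"
      and "ereal v \<le> innerLP_OST ExAnte k n m G J \<rho>"
      using innerLP_OST_ExAnte_ge[OF k _ s] unfolding n v_def by blast
    thus "ereal v \<le> (SUP (J, \<rho>)\<in>{1..m} \<times> {0<..1}. innerLP_OST ExAnte k n m G J \<rho>)"
      by (intro SUP_upper2[of "(J, \<rho>)"]) auto
  qed
  moreover have "?ST Proph \<le> ereal v"
  proof (rule ereal_le_epsilon2)
    fix e :: real assume "0 < e"
    define \<epsilon> where "\<epsilon> = min e (1 / 2)"
    have \<epsilon>: "0 < \<epsilon>" "\<epsilon> < 1" "\<epsilon> \<le> e" using \<open>0 < e\<close> by (auto simp: \<epsilon>_def)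
    have "?ST Proph \<le> innerLP_ST Proph k n 3 (hard_instance n \<epsilon>)"
      using hard_instance_type_distribution[of \<epsilon> n] \<epsilon>
      by (intro INF_lower2[of "(3, hard_instance n \<epsilon>)"]) auto
    also have "\<dots> \<le> ereal (v + \<epsilon>)"
      unfolding n v_def by (rule innerLP_ST_hard_instance_le[OF k \<epsilon>(1,2) s])
    also have "\<dots> \<le> ereal v + ereal e" using \<epsilon> by simp
    finally show "?ST Proph \<le> ereal v + ereal e" .
  qed
  \<comment> \<open>The largest of the four values is now at most the smallest, so all inequalities
    between them are equalities.\<close>
  ultimately have "?ST Proph \<le> ?OST ExAnte" by (rule order_trans[rotated])
  thus ?thesis using ST OST OST_ST[of Proph] OST_ST[of ExAnte] by (intro conjI antisym) (blast intro: order_trans)+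
qed

end
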